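(* Let $\mathbb{T}$ be a time scale, $a,b\in\mathbb{T}$ with $a<b$, and $\mathbb{T}_\ast:=[a,b]_{\mathbb{T}}$. Let $u:\mathbb{T}_\ast\to\mathbb{R}$ be a nonnegative rd-continuous function, let $h,f:\mathbb{T}_\ast^{\kappa}\to\mathbb{R}$ be nonnegative rd-continuous functions, and let $b(\cdot)$ be a nonnegative rd-continuous function that is not identically zero on $\mathbb{T}_\ast^{\kappa^2}$. Let $\Phi\in C(\mathbb{R}^+_0,\mathbb{R}^+_0)$ be a nondecreasing, subadditive and submultiplicative function such that $\Phi(x)>0$ for $x>0$, and let $W\in C(\mathbb{R}^+_0,\mathbb{R}^+_0)$ be a nondecreasing function such that $W(x)>0$ for $x>0$. Let $a(\cdot):\mathbb{T}_\ast\to(0,\infty)$ be a positive, rd-continuous and nondecreasing function. Suppose that for all $t\in\mathbb{T}_\ast$ $$u(t)\leq a(t)+\int_a^t f(s)u(s)\Delta s+\int_a^t f(s)h(s)W\left(\int_a^s b(\tau)\Phi(u(\tau))\Delta\tau\right)\Delta s.$$ Define $$p(t)=1+\int_a^t f(s)e_f(t,\sigma(s))\Delta s,\qquad \xi=\int_a^{\rho(b)}b(s)\Phi(p(s)a(s))\Delta s,$$ $$\Psi(x)=\int_{x_0}^x\frac{1}{\Phi(W(s))}\,ds,\quad x>0,\ x_0>0,$$ and let $\Psi^{-1}$ be the inverse of $\Psi$. Then for all $t\in\mathbb{T}_\ast$ satisfying $$\Psi(\xi)+\int_a^{\rho(t)}b(\tau)\Phi(p(\tau))\Phi\left(\int_a^\tau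 f(\theta)h(\theta)\Delta\theta\right)\Delta\tau\in \mathrm{Dom}(\Psi^{-1})$$ we have $$u(t)\leq p(t)a(t)+p(t)\int_a^t f(s)h(s)W\left[\Psi^{-1}\left(\Psi(\xi)+\int_a^s b(\tau)\Phi(p(\tau))\Phi\left(\int_a^\tau f(\theta)h(\theta)\Delta\theta\right)\Delta\tau\right)\right]\Delta s.$$
   Context: A time scale $\mathbb{T}$ is a nonempty closed subset of $\mathbb{R}$. $\mathbb{R}^+_0=[0,\infty)$. For $a<b$ in $\mathbb{T}$, $[a,b]_{\mathbb{T}}=\{t\in\mathbb{T}:a\leq t\leq b\}$, and $\mathbb{T}_\ast=[a,b]_{\mathbb{T}}$ is regarded as a time scale itself. On $\mathbb{T}_\ast$: $\sigma(t)=\inf\{s\in\mathbb{T}_\ast:s>t\}$ (with $\sigma(b)=b$), $\rho(t)=\sup\{s\in\mathbb{T}_\ast:s<t\}$ (with $\rho(a)=a$). $\mathbb{T}_\ast^{\kappa}=\mathbb{T}_\ast\setminus\{b\}$ if $\rho(b)<b$ and $\mathbb{T}_\ast^{\kappa}=\mathbb{T}_\ast$ otherwise; $\mathbb{T}_\ast^{\kappa^2}=(\mathbb{T}_\ast^{\kappa})^{\kappa}$. $\int\cdot\,\Delta s$ is the delta integral. A function is rd-continuous if it is continuous at right-dense points ($\sigma(t)=t$) and has finite left-sided limits at left-dense points ($\rho(t)=t$). For $f\ge 0$ rd-continuous, $e_f(\cdot,s)$ is the time scale exponential function: the unique solution of $y^\Delta=f y$, $y(s)=1$, where $y^\Delta$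 is the delta derivative. Subadditive: $\Phi(x+y)\le\Phi(x)+\Phi(y)$; submultiplicative: $\Phi(xy)\le\Phi(x)\Phi(y)$, for all $x,y\ge0$. $\Psi$ is defined on $(0,\infty)$ with a fixed $x_0>0$, and $\mathrm{Dom}(\Psi^{-1})$ is the range of $\Psi$. The functions $a(\cdot)$ and $b(\cdot)$, always written with an argument, are distinct from the endpoints $a$ and $b$; $b(\cdot)$ is defined (at least) on $\mathbb{T}_\ast^{\kappa}$. *)

theory Defs
  imports "HOL-Analysis.Analysis"
begin

definition time_scale :: "real set \<Rightarrow> bool" where
  "time_scale T \<longleftrightarrow> closed T \<and> T \<noteq> {}"

text \<open>Jump operators. The case distinctions encode the conventions
  \<open>\<sigma> (max T) = max T\<close> and \<open>\<rho> (min T) = min T\<close>.\<close>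

definition fwd_jump :: "real set \<Rightarrow> real \<Rightarrow> real" where
  "fwd_jump T t = (if \<exists>s\<in>T. t < s then Inf {s \<in> T. t < s} else t)"

definition bwd_jump :: "real set \<Rightarrow> real \<Rightarrow> real" where
  "bwd_jump T t = (if \<exists>s\<in>T. s < t then Sup {s \<in> T. s < t} else t)"

definition ts_kappa :: "real set \<Rightarrow> real set" where
  "ts_kappa T = {t \<in> T. \<not> ((\<forall>s\<in>T. s \<le> t) \<and> bwd_jump T t < t)}"

text \<open>Rd-continuity on \<open>D \<subseteq> T\<close>; density of points is understood with respect to \<open>T\<close>.\<close>

definition rd_continuous_on :: "real set \<Rightarrow> real set \<Rightarrow> (real \<Rightarrow> real) \<Rightarrow> bool" where
  "rd_continuous_on T D g \<longleftrightarrow>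
     (\<forall>t\<in>D. fwd_jump T t = t \<longrightarrow> continuous (at t within D) g) \<and>
     (\<forall>t\<in>D. bwd_jump T t = t \<longrightarrow> (\<exists>l. (g \<longlongrightarrow> l) (at t within D \<inter> {..<t})))"

text \<open>Hilger's delta derivative. It determines \<open>L\<close> only for \<open>t \<in> ts_kappa T\<close> (and \<open>T\<close> not
  a singleton).\<close>

definition has_delta_derivative :: "real set \<Rightarrow> (real \<Rightarrow> real) \<Rightarrow> real \<Rightarrow> real \<Rightarrow> bool" where
  "has_delta_derivative T g L t \<longleftrightarrow>
     (\<forall>\<epsilon>>0. \<exists>\<delta>>0. \<forall>s\<in>T. \<bar>s - t\<bar> < \<delta> \<longrightarrow>
        \<bar>g (fwd_jump T t) - g s - L * (fwd_jump T t - s)\<bar> \<le> \<epsilon> * \<bar>fwd_jump T t - s\<bar>)"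

text \<open>The delta integral \<open>F s - F r\<close> for an antiderivative \<open>F\<close> of \<open>g\<close>. The antiderivative is only
  required on the segment \<open>S\<close> between \<open>r\<close> and \<open>s\<close>, so that values of \<open>g\<close> outside \<open>[r, s)\<close> do not
  matter. At the right end point only continuity of \<open>F\<close> is demanded: if that point is left-dense
  in \<open>S\<close> but right-scattered in \<open>T\<close>, an rd-continuous \<open>g\<close> may jump there, and the derivative of
  \<open>F\<close> within \<open>S\<close> is then the left limit of \<open>g\<close>. An antiderivative on all of \<open>T\<close> restricts to
  an antiderivative on \<open>S\<close> in this sense, and two of them differ by a constant.\<close>

definition delta_antiderivative ::
    "real set \<Rightarrow> real \<Rightarrow> real \<Rightarrow> (real \<Rightarrow> real) \<Rightarrow> (real \<Rightarrow> real) \<Rightarrow> bool" where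
  "delta_antiderivative T r s g F \<longleftrightarrow>
     (let S = T \<inter> {r..s} in
        continuous_on S F \<and> (\<forall>x\<in>S - {s}. has_delta_derivative S F (g x) x))"

definition delta_integral :: "real set \<Rightarrow> real \<Rightarrow> real \<Rightarrow> (real \<Rightarrow> real) \<Rightarrow> real" where
  "delta_integral T r s g =
     (if r \<le> s then (THE I. \<exists>F. delta_antiderivative T r s g F \<and> I = F s - F r)
      else (THE I. \<exists>F. delta_antiderivative T s r g F \<and> I = F s - F r))"

text \<open>\<open>ts_exp T f t s\<close> is \<open>e\<^sub>f(t, s)\<close>: the value at \<open>t\<close> of the solution \<open>y\<close> of the initial value
  problem. The solution is unique on \<open>T\<close> only, hence the description of its value.\<close>

definition ts_exp :: "real set \<Rightarrow> (real \<Rightarrow> real) \<Rightarrow> real \<Rightarrow> real \<Rightarrow> real" where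
  "ts_exp T f t s =
     (THE v. \<exists>y. (\<forall>x\<in>ts_kappa T. has_delta_derivative T y (f x * y x) x) \<and> y s = 1 \<and> v = y t)"

end

theory Submission
  imports Defs
begin

text \<open>Put \<open>V(t) = \<integral>\<^sub>a\<^sup>t b(\<cdot>) \<Phi>(u)\<close>, \<open>Z(t) = \<integral>\<^sub>a\<^sup>t f h W(V)\<close> and \<open>H(t) = \<integral>\<^sub>a\<^sup>t f h\<close>. Since
  \<open>(1/e\<^sub>f(\<cdot>, a))\<^sup>\<Delta> = - f / e\<^sub>f(\<sigma>(\<cdot>), a)\<close>, the function \<open>p\<close> is \<open>e\<^sub>f(\<cdot>, a)\<close>, and the Gronwall inequality gives
  \<open>u \<le> p (a(\<cdot>) + Z)\<close>. With \<open>Z \<le> W(V) H\<close> and the assumptions on \<open>\<Phi>\<close> this becomes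
  \<open>V \<le> \<xi> + \<integral>\<^sub>a b(\<cdot>) \<Phi>(p) \<Phi>(H) \<Phi>(W(V)) =: R\<close> on \<open>[a, \<rho>(b)]\<close>, and \<open>\<Psi>(R)\<close> grows no faster than
  \<open>\<integral>\<^sub>a b(\<cdot>) \<Phi>(p) \<Phi>(H)\<close>, which bounds \<open>V\<close> and hence \<open>Z\<close>.

  An antiderivative of an rd-continuous \<open>g\<close> is the ordinary integral of the step extension of \<open>g\<close>
  that is constant on the gaps of the time scale.

  If \<open>b(\<cdot>)\<close> is nonzero only at a left-dense, right-scattered \<open>\<rho>(b)\<close>, then \<open>\<xi> = 0\<close> and \<open>\<Psi>(\<xi>)\<close> may be
  a junk value; but then \<open>V = 0\<close> on \<open>[a, \<rho>(b)]\<close>, and any positive value of \<open>\<Psi>\<^sup>-\<^sup>1\<close> suffices.\<close>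

section \<open>Forward and backward jumps\<close>

lemma fwd_jump_ge: "t \<le> fwd_jump T t"
  unfolding fwd_jump_def by (auto intro!: cInf_greatest)

lemma fwd_jump_le:
  assumes "s \<in> T" "t < s"
  shows "fwd_jump T t \<le> s"
  using assms unfolding fwd_jump_def
  by (auto intro!: cInf_lower bdd_belowI[where m = t])

lemma fwd_jump_in:
  assumes "closed T" "s \<in> T" "t < s"
  shows "fwd_jump T t \<in> T"
proof -
  have "Inf {s \<in> T. t < s} \<in> closure {s \<in> T. t < s}"
    using assms by (intro closure_contains_Inf) (auto intro!: bdd_belowI[where m = t])
  also have "\<dots> \<subseteq> T"
    using assms by (intro closure_minimal) auto
  finally show ?thesis
    using assms unfolding fwd_jump_def by auto
qed

lemma fwd_jump_dense:
  assumes "s \<in> T" "t < s" "fwd_jump T t = t" "t < c"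
  shows "\<exists>y\<in>T. t < y \<and> y < c"
proof -
  have "Inf {s \<in> T. t < s} < c"
    using assms unfolding fwd_jump_def by (auto split: if_splits)
  then show ?thesis
    using assms cInf_lessD[of "{s \<in> T. t < s}" c] by blast
qed

lemma fwd_jump_gap:
  assumes "y \<in> T" "t < y" "y < fwd_jump T t"
  shows False
  using fwd_jump_le[OF assms(1,2)] assms(3) by simp

text \<open>Delta integrals treat a segment as a time scale of its own. Before \<open>s\<close> the
  jumps agree because \<open>s\<close> is itself a candidate in the infimum; at \<open>s\<close>
  they may differ.\<close>

lemma fwd_jump_restrict:
  assumes "s \<in> T" "r \<le> x" "x < s"
  shows "fwd_jump (T \<inter> {r..s}) x = fwd_jump T x"
proof (rule antisym)
  have s: "s \<in> T \<inter> {r..s}"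
    using assms by auto
  have bd: "bdd_below {y \<in> T \<inter> {r..s}. x < y}"
    by (auto intro!: bdd_belowI[where m = x])
  have eq: "fwd_jump (T \<inter> {r..s}) x = Inf {y \<in> T \<inter> {r..s}. x < y}"
    using s assms unfolding fwd_jump_def by auto
  have eq': "fwd_jump T x = Inf {y \<in> T. x < y}"
    using assms unfolding fwd_jump_def by auto
  show "fwd_jump (T \<inter> {r..s}) x \<le> fwd_jump T x"
    unfolding eq'
  proof (rule cInf_greatest)
    show "{y \<in> T. x < y} \<noteq> {}"
      using assms by auto
    fix y assume y: "y \<in> {y \<in> T. x < y}"
    show "fwd_jump (T \<inter> {r..s}) x \<le> y"
    proof (cases "y \<le> s")
      case True
      then show ?thesis using y assms by (intro fwd_jump_le) auto
    next
      case False
      have "fwd_jump (T \<inter> {r..s}) x \<le> s"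
        using s assms by (intro fwd_jump_le) auto
      with False show ?thesis by simp
    qed
  qed
  show "fwd_jump T x \<le> fwd_jump (T \<inter> {r..s}) x"
    unfolding eq using s assms by (intro cInf_greatest) (auto intro: fwd_jump_le)
qed

lemma bwd_jump_le: "bwd_jump T t \<le> t"
  unfolding bwd_jump_def by (auto intro!: cSup_least)

lemma bwd_jump_ge:
  assumes "s \<in> T" "s < t"
  shows "s \<le> bwd_jump T t"
  using assms unfolding bwd_jump_def
  by (auto intro!: cSup_upper bdd_aboveI[where M = t])

lemma bwd_jump_in:
  assumes "closed T" "s \<in> T" "s < t"
  shows "bwd_jump T t \<in> T"
proof -
  have "Sup {s \<in> T. s < t} \<in> closure {s \<in> T. s < t}"
    using assms by (intro closure_contains_Sup) (auto intro!: bdd_aboveI[where M = t])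
  also have "\<dots> \<subseteq> T"
    using assms by (intro closure_minimal) auto
  finally show ?thesis
    using assms unfolding bwd_jump_def by auto
qed

lemma bwd_jump_dense:
  assumes "s \<in> T" "s < t" "bwd_jump T t = t" "c < t"
  shows "\<exists>y\<in>T. c < y \<and> y < t"
proof -
  have "c < Sup {s \<in> T. s < t}"
    using assms unfolding bwd_jump_def by (auto split: if_splits)
  then show ?thesis
    using assms less_cSupD[of "{s \<in> T. s < t}" c] by blast
qed

section \<open>The delta derivative at right-dense and right-scattered points\<close>

lemma has_delta_derivative_dense:
  assumes "fwd_jump T x = x"
  shows "has_delta_derivative T F L x \<longleftrightarrow> (F has_real_derivative L) (at x within T)"
proof -
  have "\<bar>F x - F s - L * (x - s)\<bar> = \<bar>F s - F x - L * (s - x)\<bar>" for s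
    by (simp add: abs_if algebra_simps)
  then show ?thesis
    unfolding has_delta_derivative_def has_field_derivative_def has_derivative_within_alt assms
    by (simp add: bounded_linear_mult_right abs_minus_commute)
qed

text \<open>Choosing the test point \<open>s = x\<close> and letting the tolerance tend to 0 forces
  the slope across the gap. With that slope known, the defining estimate compares \<open>F s\<close>
  with \<open>F x\<close> for \<open>s\<close> near \<open>x\<close>, so it expresses
  continuity.\<close>

lemma has_delta_derivative_scattered:
  assumes x: "x \<in> T" and less: "x < fwd_jump T x"
  shows "has_delta_derivative T F L x \<longleftrightarrow>
    continuous (at x within T) F \<and> F (fwd_jump T x) - F x = L * (fwd_jump T x - x)"
proof -
  define y where "y = fwd_jump T x"
  define m where "m = y - x"
  have m: "m > 0"
    using less by (simp add: m_def y_def)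
  show ?thesis
    unfolding y_def[symmetric] m_def[symmetric]
  proof safe
    assume D: "has_delta_derivative T F L x"
    show eq: "F y - F x = L * m"
    proof (rule ccontr)
      assume ne: "F y - F x \<noteq> L * m"
      \<comment> \<open>With this tolerance the test point \<open>x\<close>, at distance
        \<open>m\<close> from \<open>y\<close>, bounds the positive defect by half of
        itself.\<close>
      define e where "e = \<bar>F y - F x - L * m\<bar> / (2 * m)"
      have "e > 0"
        using ne m by (simp add: e_def)
      then obtain d where "d > 0" and
        d: "\<forall>s\<in>T. \<bar>s - x\<bar> < d \<longrightarrow> \<bar>F y - F s - L * (y - s)\<bar> \<le> e * \<bar>y - s\<bar>"
        using D unfolding has_delta_derivative_def y_def by blast
      then have "\<bar>F y - F x - L * m\<bar> \<le> e * m"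
        using x m by (auto simp: m_def)
      then show False
        using ne m by (simp add: e_def)
    qed
    show "continuous (at x within T) F"
      unfolding continuous_within_eps_delta
    proof (intro allI impI)
      fix e :: real assume e: "e > 0"
      define e' where "e' = e / (2 * (m + 1))"
      have e': "e' > 0"
        using e m by (simp add: e'_def)
      then obtain d where "d > 0" and
        d: "\<forall>s\<in>T. \<bar>s - x\<bar> < d \<longrightarrow> \<bar>F y - F s - L * (y - s)\<bar> \<le> e' * \<bar>y - s\<bar>"
        using D unfolding has_delta_derivative_def y_def by blast
      define d' where "d' = min d (min 1 (e / (2 * (\<bar>L\<bar> + 1))))"
      have "\<bar>F s - F x\<bar> < e" if s: "s \<in> T" "\<bar>s - x\<bar> < d'" for s
      proof -
        \<comment> \<open>The increment from \<open>x\<close> to \<open>y\<close> cancels, so the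
          estimate speaks of \<open>F x - F s\<close>. Half of \<open>e\<close> covers it, the other
          half covers the linear term.\<close>
        have "F y - F s - L * (y - s) = F x - F s - L * (x - s)"
          using eq by (simp add: m_def algebra_simps)
        then have "\<bar>F x - F s - L * (x - s)\<bar> \<le> e' * \<bar>y - s\<bar>"
          using d s by (auto simp: d'_def)
        also have "\<dots> \<le> e' * (m + 1)"
          using s e' less by (intro mult_left_mono) (auto simp: d'_def m_def y_def)
        also have "\<dots> = e / 2"
          using m by (simp add: e'_def field_simps)
        finally have A: "\<bar>F x - F s - L * (x - s)\<bar> \<le> e / 2" .
        have "\<bar>L * (x - s)\<bar> \<le> (\<bar>L\<bar> + 1) * \<bar>s - x\<bar>"
          by (simp add: abs_mult abs_minus_commute mult_right_mono)
        also have "\<dots> < (\<bar>L\<bar> + 1) * (e / (2 * (\<bar>L\<bar> + 1)))"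
          using s by (intro mult_strict_left_mono) (auto simp: d'_def)
        also have "\<dots> = e / 2"
          using abs_ge_zero[of L] by (simp add: field_simps)
        finally show ?thesis
          using A by linarith
      qed
      moreover have "d' > 0"
        using \<open>d > 0\<close> e by (simp add: d'_def)
      ultimately show "\<exists>d>0. \<forall>x'\<in>T. dist x' x < d \<longrightarrow> dist (F x') (F x) < e"
        by (auto simp: dist_real_def)
    qed
  next
    assume cont: "continuous (at x within T) F" and eq: "F y - F x = L * m"
    show "has_delta_derivative T F L x"
      unfolding has_delta_derivative_def y_def[symmetric]
    proof (intro allI impI)
      fix e :: real assume e: "e > 0"
      have "continuous (at x within T) (\<lambda>s. F s - L * s)"
        using cont by (intro continuous_intros) auto
      then obtain d where "d > 0" and
        d: "\<forall>s\<in>T. \<bar>s - x\<bar> < d \<longrightarrow> \<bar>(F s - L * s) - (F x - L * x)\<bar> < e * m"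
        using mult_pos_pos[OF e m] unfolding continuous_within_eps_delta dist_real_def by blast
      \<comment> \<open>The gap is empty, so points of \<open>T\<close> within distance
        \<open>m\<close> of \<open>x\<close> do not lie to the right of \<open>x\<close>. Hence
        \<open>y - s\<close> is at least \<open>m\<close>, and continuity of
        \<open>F s - L * s\<close> with tolerance \<open>e * m\<close> suffices.\<close>
      have "\<bar>F y - F s - L * (y - s)\<bar> \<le> e * \<bar>y - s\<bar>" if s: "s \<in> T" "\<bar>s - x\<bar> < min d m" for s
      proof -
        have "s < y"
          using s m unfolding m_def by auto
        then have "s \<le> x"
          using fwd_jump_gap[of s T x] s unfolding y_def by force
        have "F y - F s - L * (y - s) = - ((F s - L * s) - (F x - L * x))"
          using eq by (simp add: m_def algebra_simps)
        then have "\<bar>F y - F s - L * (y - s)\<bar> \<le> e * m"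
          using d s by force
        also have "\<dots> \<le> e * \<bar>y - s\<bar>"
          using e \<open>s \<le> x\<close> by (intro mult_left_mono) (auto simp: m_def)
        finally show ?thesis .
      qed
      then show "\<exists>\<delta>>0. \<forall>s\<in>T. \<bar>s - x\<bar> < \<delta> \<longrightarrow> \<bar>F y - F s - L * (y - s)\<bar> \<le> e * \<bar>y - s\<bar>"
        using \<open>d > 0\<close> m by (intro exI[of _ "min d m"]) auto
    qed
  qed
qed

lemma has_delta_derivative_imp_continuous:
  assumes "x \<in> T" "has_delta_derivative T F L x"
  shows "continuous (at x within T) F"
proof (cases "fwd_jump T x = x")
  case True
  then show ?thesis
    using assms has_delta_derivative_dense DERIV_continuous by blast
next
  case False
  then show ?thesis
    using assms fwd_jump_ge[of x T] has_delta_derivative_scattered[of x T] by auto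
qed

lemma has_delta_derivative_restrict:
  assumes "has_delta_derivative T F L x" "s \<in> T" "r \<le> x" "x < s"
  shows "has_delta_derivative (T \<inter> {r..s}) F L x"
  using assms(1) unfolding has_delta_derivative_def fwd_jump_restrict[OF assms(2-4)]
  by blast

section \<open>Monotonicity on time scales and uniqueness of the delta integral\<close>

text \<open>With a slack \<open>\<epsilon> (x - r)\<close> the inequality propagates past every point: across a gap by
  \<open>scattered\<close>, otherwise by the derivative; hence the set where it holds has no supremum below \<open>s\<close>.\<close>

lemma time_scale_mono:
  fixes F :: "real \<Rightarrow> real"
  assumes "closed T" "r \<in> T" "s \<in> T" "r \<le> s"
    and cont: "continuous_on (T \<inter> {r..s}) F"
    and dense: "\<And>x. x \<in> T \<Longrightarrow> r \<le> x \<Longrightarrow> x < s \<Longrightarrow> fwd_jump T x = x \<Longrightarrow>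
      \<exists>L\<ge>0. (F has_real_derivative L) (at x within T)"
    and scattered: "\<And>x. x \<in> T \<Longrightarrow> r \<le> x \<Longrightarrow> x < s \<Longrightarrow> x < fwd_jump T x \<Longrightarrow>
      F x \<le> F (fwd_jump T x)"
  shows "F r \<le> F s"
proof (rule field_le_epsilon)
  fix e0 :: real assume "e0 > 0"
  \<comment> \<open>The total slack \<open>e * (s - r)\<close> is at most \<open>e0\<close>; the
    summand 1 covers \<open>r = s\<close>.\<close>
  define e where "e = e0 / (s - r + 1)"
  have e: "e > 0"
    using \<open>e0 > 0\<close> assms(4) by (simp add: e_def)
  define S where "S = T \<inter> {r..s}"
  have S: "closed S" "r \<in> S" "s \<in> S"
    using assms by (auto simp: S_def)
  define B where "B = {x \<in> S. F r \<le> F x + e * (x - r)}"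
  have "closed B"
  proof -
    have "B = S \<inter> (\<lambda>x. F x + e * (x - r)) -` {F r..}"
      by (auto simp: B_def)
    moreover have "continuous_on S (\<lambda>x. F x + e * (x - r))"
      using cont unfolding S_def by (intro continuous_intros)
    ultimately show ?thesis
      using S(1) by (simp add: continuous_closed_preimage)
  qed
  \<comment> \<open>\<open>A\<close> asks for the inequality at all earlier points too, so
    everything below its supremum \<open>c\<close> lies in \<open>B\<close>; \<open>c\<close> itself
    does because \<open>B\<close> is closed.\<close>
  define A where "A = {t \<in> S. \<forall>x\<in>S. x \<le> t \<longrightarrow> x \<in> B}"
  have "r \<in> A"
    using S by (auto simp: A_def B_def S_def)
  have bdd: "bdd_above A"
    by (auto intro!: bdd_aboveI[where M = s] simp: A_def S_def)
  define c where "c = Sup A"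
  have "c \<in> closure A"
    unfolding c_def using \<open>r \<in> A\<close> bdd by (intro closure_contains_Sup) auto
  also have "\<dots> \<subseteq> B"
    using \<open>closed B\<close> by (intro closure_minimal) (auto simp: A_def)
  finally have "c \<in> B" .
  then have "c \<in> S"
    by (auto simp: B_def)
  have below: "x \<in> B" if x: "x \<in> S" "x < c" for x
  proof -
    obtain t where "t \<in> A" "x < t"
      using x less_cSupD[of A x] \<open>r \<in> A\<close> unfolding c_def by blast
    with x show ?thesis by (auto simp: A_def)
  qed
  have upper: "y \<le> c" if "y \<in> A" for y
    unfolding c_def using bdd that by (intro cSup_upper)
  have "c = s"
  proof (rule ccontr)
    assume "c \<noteq> s"
    with \<open>c \<in> S\<close> have c: "c \<in> T" "r \<le> c" "c < s"
      by (auto simp: S_def)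
    show False
    proof (cases "fwd_jump T c = c")
      case False
      define y where "y = fwd_jump T c"
      have y: "c < y" "y \<in> T" "y \<le> s"
        using False fwd_jump_ge[of c T] fwd_jump_in[OF assms(1,3) c(3)]
          fwd_jump_le[OF assms(3) c(3)] by (auto simp: y_def)
      have "F c \<le> F y"
        using scattered[OF c] y by (simp add: y_def)
      moreover have "e * (c - r) \<le> e * (y - r)"
        using y e by (intro mult_left_mono) auto
      ultimately have "y \<in> B"
        using \<open>c \<in> B\<close> y c by (auto simp: B_def S_def)
      have "x \<in> B" if x: "x \<in> S" "x \<le> y" for x
      proof -
        have "x < c \<or> x = c \<or> x = y"
          using x fwd_jump_gap[of x T c] by (force simp: y_def S_def)
        then show ?thesis
          using below x \<open>c \<in> B\<close> \<open>y \<in> B\<close> by auto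
      qed
      then have "y \<in> A"
        using \<open>y \<in> B\<close> by (auto simp: A_def B_def)
      with upper y show False by force
    next
      case True
      obtain L where L: "L \<ge> 0" "(F has_real_derivative L) (at c within T)"
        using dense[OF c True] by blast
      then obtain d where "d > 0" and
        d: "\<And>y. y \<in> T \<Longrightarrow> \<bar>y - c\<bar> < d \<Longrightarrow> \<bar>F y - F c - L * (y - c)\<bar> \<le> e * \<bar>y - c\<bar>"
        using e unfolding has_field_derivative_def has_derivative_within_alt real_norm_def
        by blast
      \<comment> \<open>As \<open>L\<close> is nonnegative, \<open>F\<close> loses at most
        \<open>e * (x - c)\<close> between \<open>c\<close> and \<open>x\<close>, which is exactly
        the growth of the slack.\<close>
      have near: "x \<in> B" if x: "x \<in> S" "c < x" "x < c + d" for x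
      proof -
        have "\<bar>F x - F c - L * (x - c)\<bar> \<le> e * (x - c)"
          using d[of x] x by (auto simp: S_def)
        moreover have "L * (x - c) \<ge> 0"
          using x L by simp
        ultimately have "F c - e * (x - c) \<le> F x"
          by linarith
        then show ?thesis
          using \<open>c \<in> B\<close> x by (auto simp: B_def algebra_simps)
      qed
      obtain y where y: "y \<in> T" "c < y" "y < min s (c + d)"
        using fwd_jump_dense[OF assms(3) c(3) True, of "min s (c + d)"] c \<open>d > 0\<close> by auto
      have "x \<in> B" if "x \<in> S" "x \<le> y" for x
        using that below[of x] near[of x] \<open>c \<in> B\<close> y by (cases x c rule: linorder_cases) auto
      then have "y \<in> A"
        using y c by (auto simp: A_def S_def)
      with upper y show False by force
    qed
  qed
  then have "F r \<le> F s + e * (s - r)"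
    using \<open>c \<in> B\<close> by (auto simp: B_def)
  also have "e * (s - r) \<le> e0"
    using \<open>e0 > 0\<close> assms(4) by (simp add: e_def field_simps)
  finally show "F r \<le> F s + e0"
    by simp
qed

text \<open>The monotonicity principle applies to \<open>G - F\<close> on the segment as a time
  scale of its own: the derivative at a dense point and the slope across a gap are both
  \<open>k x - g x\<close>.\<close>

lemma delta_antiderivative_diff_le:
  assumes "closed T" "r \<in> T" "s \<in> T" "r \<le> s"
    and F: "delta_antiderivative T r s g F" and G: "delta_antiderivative T r s k G"
    and le: "\<And>x. x \<in> T \<Longrightarrow> r \<le> x \<Longrightarrow> x < s \<Longrightarrow> g x \<le> k x"
  shows "F s - F r \<le> G s - G r"
proof -
  define S where "S = T \<inter> {r..s}"
  have SS: "S \<inter> {r..s} = S"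
    by (auto simp: S_def)
  have cont: "continuous_on S F" "continuous_on S G"
    using F G by (auto simp: delta_antiderivative_def Let_def S_def)
  have D: "has_delta_derivative S F (g x) x" "has_delta_derivative S G (k x) x"
    if "x \<in> S" "x < s" for x
    using F G that by (auto simp: delta_antiderivative_def Let_def S_def)
  have "G r - F r \<le> G s - F s"
  proof (rule time_scale_mono[where T = S and F = "\<lambda>x. G x - F x"])
    show "closed S" "r \<in> S" "s \<in> S" "r \<le> s"
      using assms by (auto simp: S_def)
    show "continuous_on (S \<inter> {r..s}) (\<lambda>x. G x - F x)"
      unfolding SS using cont by (intro continuous_intros)
  next
    fix x assume x: "x \<in> S" "r \<le> x" "x < s" "fwd_jump S x = x"
    have "((\<lambda>x. G x - F x) has_real_derivative (k x - g x)) (at x within S)"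
      using D[OF x(1,3)] x(4) by (intro DERIV_diff) (auto simp: has_delta_derivative_dense)
    then show "\<exists>L\<ge>0. ((\<lambda>x. G x - F x) has_real_derivative L) (at x within S)"
      using le[of x] x by (intro exI[of _ "k x - g x"]) (auto simp: S_def)
  next
    fix x assume x: "x \<in> S" "r \<le> x" "x < s" "x < fwd_jump S x"
    have "F (fwd_jump S x) - F x = g x * (fwd_jump S x - x)"
      "G (fwd_jump S x) - G x = k x * (fwd_jump S x - x)"
      using D[OF x(1,3)] x by (auto simp: has_delta_derivative_scattered)
    moreover have "g x * (fwd_jump S x - x) \<le> k x * (fwd_jump S x - x)"
      using le[of x] x by (intro mult_right_mono) (auto simp: S_def)
    ultimately show "G x - F x \<le> G (fwd_jump S x) - F (fwd_jump S x)"
      by linarith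
  qed
  then show ?thesis by simp
qed

text \<open>Comparing two antiderivatives of the same \<open>g\<close> in both directions shows that
  their increments agree, so the definite description denotes.\<close>

lemma delta_integral_eq:
  assumes "closed T" "r \<in> T" "s \<in> T" "r \<le> s"
    and F: "delta_antiderivative T r s g F"
  shows "delta_integral T r s g = F s - F r"
proof -
  have "(THE I. \<exists>F. delta_antiderivative T r s g F \<and> I = F s - F r) = F s - F r"
  proof (rule the_equality)
    fix I assume "\<exists>F. delta_antiderivative T r s g F \<and> I = F s - F r"
    then obtain G where G: "delta_antiderivative T r s g G" "I = G s - G r"
      by blast
    show "I = F s - F r"
      using delta_antiderivative_diff_le[OF assms(1-4) F G(1)]
        delta_antiderivative_diff_le[OF assms(1-4) G(1) F] G(2) by auto
  qed (use F in blast)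
  then show ?thesis
    using assms(4) by (simp add: delta_integral_def)
qed

lemma delta_antiderivative_cong:
  assumes "\<And>x. x \<in> T \<Longrightarrow> r \<le> x \<Longrightarrow> x < s \<Longrightarrow> g x = k x"
  shows "delta_antiderivative T r s g F \<longleftrightarrow> delta_antiderivative T r s k F"
  unfolding delta_antiderivative_def Let_def using assms by auto

lemma delta_integral_cong:
  assumes "r \<le> s" "\<And>x. x \<in> T \<Longrightarrow> r \<le> x \<Longrightarrow> x < s \<Longrightarrow> g x = k x"
  shows "delta_integral T r s g = delta_integral T r s k"
proof -
  have "delta_antiderivative T r s g F \<longleftrightarrow> delta_antiderivative T r s k F" for F
    by (rule delta_antiderivative_cong) (fact assms(2))
  then show ?thesis
    using assms(1) by (simp add: delta_integral_def)
qed

section \<open>Closure properties of rd-continuous functions\<close>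

lemma rd_continuous_on_cong:
  assumes "\<And>x. x \<in> D \<Longrightarrow> g x = k x"
  shows "rd_continuous_on T D g \<longleftrightarrow> rd_continuous_on T D k"
proof -
  have "continuous (at t within D) g \<longleftrightarrow> continuous (at t within D) k" if "t \<in> D" for t
    unfolding continuous_within using assms that by (intro Lim_cong_within) auto
  moreover have "(g \<longlongrightarrow> l) (at t within D \<inter> {..<t}) \<longleftrightarrow> (k \<longlongrightarrow> l) (at t within D \<inter> {..<t})" for t l
    using assms by (intro Lim_cong_within) auto
  ultimately show ?thesis
    unfolding rd_continuous_on_def by simp
qed

lemma rd_continuous_on_subset:
  assumes "rd_continuous_on T D g" "D' \<subseteq> D"
  shows "rd_continuous_on T D' g"
  unfolding rd_continuous_on_def
proof (intro conjI ballI impI)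
  fix t assume "t \<in> D'" "fwd_jump T t = t"
  then show "continuous (at t within D') g"
    using assms unfolding rd_continuous_on_def by (blast intro: continuous_within_subset)
next
  fix t assume "t \<in> D'" "bwd_jump T t = t"
  then obtain l where "(g \<longlongrightarrow> l) (at t within D \<inter> {..<t})"
    using assms unfolding rd_continuous_on_def by blast
  then show "\<exists>l. (g \<longlongrightarrow> l) (at t within D' \<inter> {..<t})"
    using assms(2) by (intro exI[of _ l]) (auto elim!: tendsto_within_subset)
qed

lemma continuous_imp_rd_continuous_on:
  assumes "continuous_on D g"
  shows "rd_continuous_on T D g"
  unfolding rd_continuous_on_def
proof (intro conjI ballI impI)
  fix t assume "t \<in> D"
  then have *: "continuous (at t within D) g"
    using assms by (simp add: continuous_on_eq_continuous_within)
  then show "continuous (at t within D) g" .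
  show "\<exists>l. (g \<longlongrightarrow> l) (at t within D \<inter> {..<t})"
    using * unfolding continuous_within by (auto elim!: tendsto_within_subset intro!: exI[of _ "g t"])
qed

lemma rd_continuous_on_add:
  assumes "rd_continuous_on T D g" "rd_continuous_on T D k"
  shows "rd_continuous_on T D (\<lambda>x. g x + k x)"
  unfolding rd_continuous_on_def
proof (intro conjI ballI impI)
  fix t assume "t \<in> D" "fwd_jump T t = t"
  then show "continuous (at t within D) (\<lambda>x. g x + k x)"
    using assms unfolding rd_continuous_on_def by (intro continuous_add) auto
next
  fix t assume "t \<in> D" "bwd_jump T t = t"
  then obtain l where "(g \<longlongrightarrow> l) (at t within D \<inter> {..<t})"
    using assms(1) unfolding rd_continuous_on_def by blast
  moreover obtain m where "(k \<longlongrightarrow> m) (at t within D \<inter> {..<t})"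
    using assms(2) \<open>t \<in> D\<close> \<open>bwd_jump T t = t\<close> unfolding rd_continuous_on_def by blast
  ultimately show "\<exists>l. ((\<lambda>x. g x + k x) \<longlongrightarrow> l) (at t within D \<inter> {..<t})"
    by (intro exI[of _ "l + m"] tendsto_add)
qed

lemma rd_continuous_on_mult:
  assumes "rd_continuous_on T D g" "rd_continuous_on T D k"
  shows "rd_continuous_on T D (\<lambda>x. g x * k x)"
  unfolding rd_continuous_on_def
proof (intro conjI ballI impI)
  fix t assume "t \<in> D" "fwd_jump T t = t"
  then show "continuous (at t within D) (\<lambda>x. g x * k x)"
    using assms unfolding rd_continuous_on_def by (intro continuous_mult) auto
next
  fix t assume "t \<in> D" "bwd_jump T t = t"
  then obtain l where "(g \<longlongrightarrow> l) (at t within D \<inter> {..<t})"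
    using assms(1) unfolding rd_continuous_on_def by blast
  moreover obtain m where "(k \<longlongrightarrow> m) (at t within D \<inter> {..<t})"
    using assms(2) \<open>t \<in> D\<close> \<open>bwd_jump T t = t\<close> unfolding rd_continuous_on_def by blast
  ultimately show "\<exists>l. ((\<lambda>x. g x * k x) \<longlongrightarrow> l) (at t within D \<inter> {..<t})"
    by (intro exI[of _ "l * m"] tendsto_mult)
qed

lemma rd_continuous_on_compose_nonneg:
  assumes g: "rd_continuous_on T D g" and nonneg: "\<And>x. x \<in> D \<Longrightarrow> 0 \<le> g x"
    and \<phi>: "continuous_on {0..} \<phi>"
  shows "rd_continuous_on T D (\<lambda>x. \<phi> (g x))"
proof -
  \<comment> \<open>The extension is continuous on the whole line, so a left-sided limit
    \<open>l\<close> of \<open>g\<close> needs no sign argument.\<close>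
  define \<psi> where "\<psi> = (\<lambda>x. \<phi> (max 0 x))"
  have "continuous_on UNIV \<psi>"
    unfolding \<psi>_def by (intro continuous_on_compose2[OF \<phi>] continuous_intros) auto
  then have \<psi>: "isCont \<psi> x" for x
    by (simp add: continuous_on_eq_continuous_at)
  have "rd_continuous_on T D (\<lambda>x. \<psi> (g x))"
    unfolding rd_continuous_on_def
  proof (intro conjI ballI impI)
    fix t assume "t \<in> D" "fwd_jump T t = t"
    then have "continuous (at t within D) g"
      using g unfolding rd_continuous_on_def by blast
    then show "continuous (at t within D) (\<lambda>x. \<psi> (g x))"
      by (rule continuous_within_compose3[OF \<psi>])
  next
    fix t assume "t \<in> D" "bwd_jump T t = t"
    then obtain l where "(g \<longlongrightarrow> l) (at t within D \<inter> {..<t})"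
      using g unfolding rd_continuous_on_def by blast
    then have "((\<lambda>x. \<psi> (g x)) \<longlongrightarrow> \<psi> l) (at t within D \<inter> {..<t})"
      by (rule isCont_tendsto_compose[OF \<psi>])
    then show "\<exists>l. ((\<lambda>x. \<psi> (g x)) \<longlongrightarrow> l) (at t within D \<inter> {..<t})"
      by blast
  qed
  moreover have "\<psi> (g x) = \<phi> (g x)" if "x \<in> D" for x
    using nonneg[OF that] by (simp add: \<psi>_def)
  ultimately show ?thesis
    by (subst rd_continuous_on_cong[where k = "\<lambda>x. \<psi> (g x)"]) simp_all
qed

section \<open>Integrability of regulated functions\<close>

lemma regulated_integrable:
  fixes g :: "real \<Rightarrow> real"
  assumes right: "\<And>x e. a \<le> x \<Longrightarrow> x < b \<Longrightarrow> 0 < e \<Longrightarrow>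
      \<exists>l d. 0 < d \<and> (\<forall>y. x < y \<and> y < x + d \<and> y < b \<longrightarrow> \<bar>g y - l\<bar> \<le> e)"
    and left: "\<And>x e. a < x \<Longrightarrow> x \<le> b \<Longrightarrow> 0 < e \<Longrightarrow>
      \<exists>l d. 0 < d \<and> (\<forall>y. x - d < y \<and> y < x \<and> a < y \<longrightarrow> \<bar>g y - l\<bar> \<le> e)"
  shows "g integrable_on {a..b}"
proof (cases "a \<le> b")
  case False
  then show ?thesis by (simp add: integrable_on_empty)
next
  case True
  \<comment> \<open>Having an integrable function uniformly within \<open>e\<close> passes to unions
    of adjacent intervals and holds on all short intervals around a point, hence on
    \<open>{a..b}\<close> by Bolzano's bisection principle. Uniform limits of integrable functions
    are integrable.\<close>
  have step: "\<exists>\<phi>. \<phi> integrable_on {a..b} \<and> (\<forall>x\<in>{a..b}. \<bar>g x - \<phi> x\<bar> \<le> e)" if e: "e > 0" for e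
  proof -
    define P where "P = (\<lambda>c d. a \<le> c \<and> d \<le> b \<longrightarrow>
      (\<exists>\<phi>. \<phi> integrable_on {c..d} \<and> (\<forall>x\<in>{c..d}. \<bar>g x - \<phi> x\<bar> \<le> e)))"
    have "P a b"
    proof (rule Bolzano[OF True])
      fix c m d assume P: "P c m" "P m d" "c \<le> m" "m \<le> d"
      show "P c d"
        unfolding P_def
      proof
        assume cd: "a \<le> c \<and> d \<le> b"
        obtain \<phi> where \<phi>: "\<phi> integrable_on {c..m}" "\<forall>x\<in>{c..m}. \<bar>g x - \<phi> x\<bar> \<le> e"
          using P cd unfolding P_def by auto
        obtain \<psi> where \<psi>: "\<psi> integrable_on {m..d}" "\<forall>x\<in>{m..d}. \<bar>g x - \<psi> x\<bar> \<le> e"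
          using P cd unfolding P_def by auto
        define \<theta> where "\<theta> = (\<lambda>x. if x \<le> m then \<phi> x else \<psi> x)"
        have "\<theta> integrable_on {c..m}"
          using \<phi>(1) by (rule integrable_spike[where S = "{}"]) (auto simp: \<theta>_def)
        moreover have "\<theta> integrable_on {m..d}"
          using \<psi>(1) by (rule integrable_spike[where S = "{m}"]) (auto simp: \<theta>_def)
        ultimately have "\<theta> integrable_on {c..d}"
          by (rule Henstock_Kurzweil_Integration.integrable_combine[OF P(3,4)])
        moreover have "\<forall>x\<in>{c..d}. \<bar>g x - \<theta> x\<bar> \<le> e"
          using \<phi>(2) \<psi>(2) by (auto simp: \<theta>_def)
        ultimately show "\<exists>\<phi>. \<phi> integrable_on {c..d} \<and> (\<forall>x\<in>{c..d}. \<bar>g x - \<phi> x\<bar> \<le> e)"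
          by blast
      qed
    next
      fix x assume x: "a \<le> x" "x \<le> b"
      obtain l d where d: "d > 0" "\<forall>y. x < y \<and> y < x + d \<and> y < b \<longrightarrow> \<bar>g y - l\<bar> \<le> e"
      proof (cases "x < b")
        case True
        then show ?thesis using right[OF x(1) _ e] that by blast
      next
        case False
        then show ?thesis using that[of 1] by auto
      qed
      obtain l' d' where d': "d' > 0" "\<forall>y. x - d' < y \<and> y < x \<and> a < y \<longrightarrow> \<bar>g y - l'\<bar> \<le> e"
      proof (cases "a < x")
        case True
        then show ?thesis using left[OF _ x(2) e] that by blast
      next
        case False
        then show ?thesis using that[of 1] x by auto
      qed
      have "P c c'" if cc': "c \<le> x" "x \<le> c'" "c' - c < min d d'" for c c'
        unfolding P_def
      proof
        assume ab: "a \<le> c \<and> c' \<le> b"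
        \<comment> \<open>Near \<open>x\<close> one constant on each side suffices. The one-sided
          bounds do not cover \<open>a\<close>, \<open>b\<close> and \<open>x\<close>, so
          \<open>g\<close> itself is taken there; finitely many points do not affect
          integrability.\<close>
        define \<phi> where "\<phi> = (\<lambda>y. if y \<in> {a, b, x} then g y else if y < x then l' else l)"
        have "\<phi> integrable_on {c..x}"
          by (rule integrable_spike[where f = "\<lambda>_. l'" and S = "{a, b, x}"])
            (auto simp: \<phi>_def integrable_const_ivl)
        moreover have "\<phi> integrable_on {x..c'}"
          by (rule integrable_spike[where f = "\<lambda>_. l" and S = "{a, b, x}"])
            (auto simp: \<phi>_def integrable_const_ivl)
        ultimately have "\<phi> integrable_on {c..c'}"
          by (rule Henstock_Kurzweil_Integration.integrable_combine[OF cc'(1,2)])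
        moreover have "\<bar>g y - \<phi> y\<bar> \<le> e" if y: "y \<in> {c..c'}" for y
        proof -
          have "\<bar>g y - l\<bar> \<le> e" if "x < y" "y \<noteq> b"
            using d(2) y cc' ab that by (auto simp: less_le)
          moreover have "\<bar>g y - l'\<bar> \<le> e" if "y < x" "y \<noteq> a"
            using d'(2) y cc' ab that by (auto simp: less_le)
          ultimately show ?thesis
            using e by (auto simp: \<phi>_def)
        qed
        ultimately show "\<exists>\<phi>. \<phi> integrable_on {c..c'} \<and> (\<forall>x\<in>{c..c'}. \<bar>g x - \<phi> x\<bar> \<le> e)"
          by blast
      qed
      then show "\<exists>d>0. \<forall>c c'. c \<le> x \<and> x \<le> c' \<and> c' - c < d \<longrightarrow> P c c'"
        using d d' by (intro exI[of _ "min d d'"]) auto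
    qed
    then show ?thesis by (simp add: P_def)
  qed
  show ?thesis
    using integrable_uniform_limit[of a b g] step by auto
qed

text \<open>Composed with this retraction, a function is frozen on each gap at its value at the left
  end. This gives the step extension.\<close>

definition floor_ts :: "real set \<Rightarrow> real \<Rightarrow> real" where
  "floor_ts T x = Sup (T \<inter> {..x})"

section \<open>Time scales with least point \<open>a\<close> and greatest point
  \<open>b\<close>\<close>

locale bounded_time_scale =
  fixes T :: "real set" and a b :: real
  assumes closed: "closed T" and a_in: "a \<in> T" and b_in: "b \<in> T" and less: "a < b"
    and sub: "T \<subseteq> {a..b}"
begin

lemma ge_a: "x \<in> T \<Longrightarrow> a \<le> x" and le_b: "x \<in> T \<Longrightarrow> x \<le> b"
  using sub by auto

lemma kappaI: "x \<in> T \<Longrightarrow> x < b \<Longrightarrow> x \<in> ts_kappa T"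
  using b_in by (force simp: ts_kappa_def)

lemma kappaD: "x \<in> ts_kappa T \<Longrightarrow> x \<in> T"
  by (auto simp: ts_kappa_def)

lemma b_kappa: "b \<in> ts_kappa T \<longleftrightarrow> bwd_jump T b = b"
  using b_in le_b bwd_jump_le[of T b] by (auto simp: ts_kappa_def)

lemma fwd_b: "fwd_jump T b = b"
  using le_b by (force simp: fwd_jump_def)

lemma fwd_in: "x \<in> T \<Longrightarrow> fwd_jump T x \<in> T"
  using fwd_jump_in[OF closed b_in, of x] fwd_b le_b[of x] b_in by (cases "x = b") auto

lemma bwd_in:
  assumes "x \<in> T"
  shows "bwd_jump T x \<in> T"
proof (cases "\<exists>s\<in>T. s < x")
  case True
  then show ?thesis
    using bwd_jump_in[OF closed] by blast
next
  case False
  then show ?thesis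
    using assms by (auto simp: bwd_jump_def)
qed

lemma floor_in:
  assumes "a \<le> x"
  shows "floor_ts T x \<in> T"
proof -
  have "floor_ts T x \<in> T \<inter> {..x}"
    unfolding floor_ts_def using assms a_in closed
    by (intro closed_contains_Sup) auto
  then show ?thesis by simp
qed

lemma floor_le:
  assumes "a \<le> x"
  shows "floor_ts T x \<le> x"
  unfolding floor_ts_def using assms a_in by (intro cSup_least) auto

lemma floor_ge: "s \<in> T \<Longrightarrow> s \<le> x \<Longrightarrow> s \<le> floor_ts T x"
  unfolding floor_ts_def by (intro cSup_upper) auto

lemma floor_eqI:
  assumes "q \<in> T" "q \<le> x" "\<And>s. s \<in> T \<Longrightarrow> q < s \<Longrightarrow> x < s"
  shows "floor_ts T x = q"
proof -
  have "a \<le> x"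
    using assms ge_a by force
  then show ?thesis
    using floor_in[of x] floor_le[of x] floor_ge[OF assms(1,2)] assms(3)[of "floor_ts T x"] by force
qed


end

section \<open>Linearity of the delta derivative\<close>

lemma has_delta_derivative_cong:
  assumes "\<And>s. s \<in> T \<Longrightarrow> F s = G s" "x \<in> T" "fwd_jump T x \<in> T"
  shows "has_delta_derivative T F L x \<longleftrightarrow> has_delta_derivative T G L x"
  unfolding has_delta_derivative_def using assms by auto

lemma has_delta_derivative_const: "has_delta_derivative T (\<lambda>_. c) 0 x"
  by (auto simp: has_delta_derivative_def intro: exI[of _ 1])

lemma has_delta_derivative_cmult:
  assumes "x \<in> T" "has_delta_derivative T F L x"
  shows "has_delta_derivative T (\<lambda>t. c * F t) (c * L) x"
proof (cases "fwd_jump T x = x")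
  case True
  then show ?thesis
    using assms(2) by (simp add: has_delta_derivative_dense DERIV_cmult)
next
  case False
  then have "x < fwd_jump T x"
    using fwd_jump_ge[of x T] by simp
  then show ?thesis
    using assms by (auto simp: has_delta_derivative_scattered continuous_intros right_diff_distrib[symmetric])
qed

lemma has_delta_derivative_add:
  assumes "x \<in> T" "has_delta_derivative T F L x" "has_delta_derivative T G M x"
  shows "has_delta_derivative T (\<lambda>t. F t + G t) (L + M) x"
proof (cases "fwd_jump T x = x")
  case True
  then show ?thesis
    using assms(2,3) by (simp add: has_delta_derivative_dense DERIV_add)
next
  case False
  then have "x < fwd_jump T x"
    using fwd_jump_ge[of x T] by simp
  then show ?thesis
    using assms by (auto simp: has_delta_derivative_scattered continuous_intros algebra_simps)
qed

section \<open>Antiderivatives of rd-continuous functions\<close>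

context bounded_time_scale
begin

text \<open>If \<open>x\<close> is right-scattered or lies inside a gap, the floor is constant just
  to the right of \<open>x\<close>. Otherwise the floor of \<open>y\<close> lies between
  \<open>x\<close> and \<open>y\<close>, so continuity of \<open>g\<close> at \<open>x\<close>
  applies.\<close>

lemma right_limit_floor:
  assumes g: "rd_continuous_on T (ts_kappa T) g" and x: "a \<le> x" "x < b" and e: "e > 0"
  shows "\<exists>l d. 0 < d \<and> (\<forall>y. x < y \<and> y < x + d \<and> y < b \<longrightarrow> \<bar>g (floor_ts T y) - l\<bar> \<le> e)"
proof (cases "fwd_jump T x = x")
  case False
  define d where "d = fwd_jump T x - x"
  have "d > 0"
    using False fwd_jump_ge[of x T] by (simp add: d_def)
  moreover have "floor_ts T y = floor_ts T x" if y: "x < y" "y < x + d" for y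
  proof (rule floor_eqI)
    show "floor_ts T x \<in> T" "floor_ts T x \<le> y"
      using floor_in[OF x(1)] floor_le[OF x(1)] y by auto
    fix s assume s: "s \<in> T" "floor_ts T x < s"
    then have "x < s"
      using floor_ge[of s x] by force
    then show "y < s"
      using fwd_jump_le[of s T x] s y by (simp add: d_def)
  qed
  ultimately show ?thesis
    using e by (intro exI[of _ "g (floor_ts T x)"] exI[of _ d]) auto
next
  case True
  then have "x \<in> T"
    using fwd_jump_in[OF closed b_in x(2)] by simp
  then have "continuous (at x within ts_kappa T) g"
    using g True kappaI x unfolding rd_continuous_on_def by blast
  then obtain d where "d > 0" and d: "\<forall>y\<in>ts_kappa T. \<bar>y - x\<bar> < d \<longrightarrow> \<bar>g y - g x\<bar> < e"
    using e unfolding continuous_within_eps_delta dist_real_def by blast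
  have "\<bar>g (floor_ts T y) - g x\<bar> \<le> e" if y: "x < y" "y < x + d" "y < b" for y
  proof -
    have "floor_ts T y \<in> T" "floor_ts T y \<le> y" "x \<le> floor_ts T y"
      using y x floor_in floor_le floor_ge[OF \<open>x \<in> T\<close>, of y] by auto
    then show ?thesis
      using d[rule_format, of "floor_ts T y"] kappaI y by force
  qed
  then show ?thesis
    using \<open>d > 0\<close> by blast
qed

lemma left_limit_floor:
  assumes g: "rd_continuous_on T (ts_kappa T) g" and x: "a < x" "x \<le> b" and e: "e > 0"
  shows "\<exists>l d. 0 < d \<and> (\<forall>y. x - d < y \<and> y < x \<and> a < y \<longrightarrow> \<bar>g (floor_ts T y) - l\<bar> \<le> e)"
proof (cases "bwd_jump T x = x")
  case False
  define q where "q = bwd_jump T x"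
  have q: "q < x" "q \<in> T"
    using False bwd_jump_le[of T x] bwd_jump_in[OF closed a_in x(1)] by (auto simp: q_def)
  have "floor_ts T y = q" if y: "q < y" "y < x" for y
  proof (rule floor_eqI)
    fix s assume s: "s \<in> T" "q < s"
    then show "y < s"
      using bwd_jump_ge[of s T x] y by (force simp: q_def)
  qed (use q y in auto)
  then show ?thesis
    using e q by (intro exI[of _ "g q"] exI[of _ "x - q"]) auto
next
  case True
  then have "x \<in> T"
    using bwd_jump_in[OF closed a_in x(1)] by simp
  \<comment> \<open>This includes \<open>x = b\<close>, since a left-dense \<open>b\<close> stays in
    \<open>ts_kappa T\<close>.\<close>
  then have "x \<in> ts_kappa T"
    using kappaI[of x] b_kappa x True by (cases "x = b") auto
  then obtain l where "(g \<longlongrightarrow> l) (at x within ts_kappa T \<inter> {..<x})"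
    using g True unfolding rd_continuous_on_def by blast
  then obtain d where "d > 0" and
    d: "\<forall>y\<in>ts_kappa T \<inter> {..<x}. 0 < \<bar>y - x\<bar> \<and> \<bar>y - x\<bar> < d \<longrightarrow> \<bar>g y - l\<bar> < e"
    using e unfolding Lim_within dist_real_def by blast
  \<comment> \<open>The floor of \<open>y\<close> may lie well below \<open>y\<close>. A point
    \<open>s\<close> of \<open>T\<close> inside the \<open>d\<close>-neighbourhood of
    \<open>x\<close> bounds it from below for all \<open>y\<close> beyond \<open>s\<close>.\<close>
  obtain s where s: "s \<in> T" "x - d < s" "s < x"
    using bwd_jump_dense[OF a_in x(1) True, of "x - d"] \<open>d > 0\<close> by auto
  have "\<bar>g (floor_ts T y) - l\<bar> \<le> e" if y: "x - (x - s) < y" "y < x" "a < y" for y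
  proof -
    have f: "floor_ts T y \<in> T" "floor_ts T y \<le> y" "s \<le> floor_ts T y"
      using y x floor_in floor_le floor_ge[OF s(1), of y] by auto
    then have "floor_ts T y \<in> ts_kappa T"
      using y x by (intro kappaI) auto
    then show ?thesis
      using d[rule_format, of "floor_ts T y"] f y s by force
  qed
  moreover have "x - s > 0"
    using s by simp
  ultimately show ?thesis
    by blast
qed

lemma integrable_floor:
  assumes "rd_continuous_on T (ts_kappa T) g"
  shows "(\<lambda>x. g (floor_ts T x)) integrable_on {a..b}"
  using right_limit_floor[OF assms] left_limit_floor[OF assms] by (intro regulated_integrable)

text \<open>The antiderivative is the integral of the step extension. Across a gap the integrand is
  the constant \<open>g x\<close>, so the slope is exact; near a right-dense \<open>x\<close> the
  integrand stays close to \<open>g x\<close>.\<close>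

lemma ex_delta_antiderivative:
  assumes g: "rd_continuous_on T (ts_kappa T) g"
  shows "\<exists>F. continuous_on T F \<and> F a = 0 \<and>
    (\<forall>x\<in>ts_kappa T. has_delta_derivative T F (g x) x)"
proof -
  define G where "G = (\<lambda>x. g (floor_ts T x))"
  define F where "F = (\<lambda>x. integral {a..x} G)"
  have int: "G integrable_on {a..b}"
    unfolding G_def by (rule integrable_floor[OF g])
  have contF: "continuous_on {a..b} F"
    unfolding F_def by (rule indefinite_integral_continuous_1[OF int])
  then have cont: "continuous_on T F"
    using sub continuous_on_subset by blast
  \<comment> \<open>One mean value estimate serves both cases, with \<open>e > 0\<close> at
    right-dense points and \<open>e = 0\<close> across a gap. The bound leaves out \<open>d\<close>,
    since at the right end of a gap the step extension has already jumped.\<close>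
  have est: "\<bar>F d - F c - L * (d - c)\<bar> \<le> e * (d - c)"
    if cd: "a \<le> c" "c \<le> d" "d \<le> b" and e: "0 \<le> e"
      and bd: "\<And>y. c \<le> y \<Longrightarrow> y < d \<Longrightarrow> \<bar>G y - L\<bar> \<le> e" for c d e L
  proof -
    have sub: "G integrable_on {a..d}" "G integrable_on {c..d}"
      using cd by (auto intro: integrable_on_subinterval[OF int])
    have "F d = F c + integral {c..d} G"
      unfolding F_def using cd sub by (simp add: Henstock_Kurzweil_Integration.integral_combine)
    moreover have "((\<lambda>y. G y - L) has_integral (integral {c..d} G - (d - c) * L)) (cbox c d)"
      using has_integral_diff[OF integrable_integral[OF sub(2)], of "\<lambda>_. L"]
        has_integral_const_real[of L c d] cd by simp
    then have "norm (integral {c..d} G - (d - c) * L) \<le> e * measure lborel (cbox c d)"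
      using e bd by (intro has_integral_bound_spike_finite[where S = "{d}"]) auto
    ultimately show ?thesis
      using cd by (simp add: algebra_simps)
  qed
  have "has_delta_derivative T F (g x) x" if x: "x \<in> ts_kappa T" for x
  proof (cases "fwd_jump T x = x")
    case True
    have xT: "x \<in> T"
      using x by (rule kappaD)
    show ?thesis
      unfolding has_delta_derivative_def True
    proof (intro allI impI)
      fix e :: real assume e: "e > 0"
      have "continuous (at x within ts_kappa T) g"
        using g True x unfolding rd_continuous_on_def by blast
      then obtain d where "d > 0" and d: "\<forall>y\<in>ts_kappa T. \<bar>y - x\<bar> < d \<longrightarrow> \<bar>g y - g x\<bar> < e"
        using e unfolding continuous_within_eps_delta dist_real_def by blast
      have "\<bar>F x - F s - g x * (x - s)\<bar> \<le> e * \<bar>x - s\<bar>" if s: "s \<in> T" "\<bar>s - x\<bar> < d" for s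
      proof -
        define l m where "l = min s x" and "m = max s x"
        have lm: "l \<in> T" "m \<in> T" "l \<le> m" "a \<le> l" "m \<le> b"
          using s xT ge_a le_b by (auto simp: l_def m_def min_def max_def)
        have "\<bar>F m - F l - g x * (m - l)\<bar> \<le> e * (m - l)"
        proof (rule est)
          fix y assume y: "l \<le> y" "y < m"
          have "floor_ts T y \<in> T" "l \<le> floor_ts T y" "floor_ts T y \<le> y"
            using y lm floor_in floor_le floor_ge[of l y] by auto
          then show "\<bar>G y - g x\<bar> \<le> e"
            using d[rule_format, of "floor_ts T y"] kappaI[of "floor_ts T y"] y lm s
            unfolding G_def l_def m_def by force
        qed (use lm e in auto)
        then show ?thesis
          by (cases "s \<le> x") (auto simp: l_def m_def abs_if algebra_simps split: if_splits)
      qed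
      then show "\<exists>\<delta>>0. \<forall>s\<in>T. \<bar>s - x\<bar> < \<delta> \<longrightarrow> \<bar>F x - F s - g x * (x - s)\<bar> \<le> e * \<bar>x - s\<bar>"
        using \<open>d > 0\<close> by blast
    qed
  next
    case False
    then have less: "x < fwd_jump T x"
      using fwd_jump_ge[of x T] by simp
    have xT: "x \<in> T"
      using x by (rule kappaD)
    have "\<bar>F (fwd_jump T x) - F x - g x * (fwd_jump T x - x)\<bar> \<le> 0 * (fwd_jump T x - x)"
    proof (rule est)
      show "a \<le> x" "x \<le> fwd_jump T x" "fwd_jump T x \<le> b"
        using xT ge_a less le_b[OF fwd_in[OF xT]] by auto
      fix y assume y: "x \<le> y" "y < fwd_jump T x"
      have "floor_ts T y = x"
      proof (rule floor_eqI)
        fix s assume "s \<in> T" "x < s"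
        then show "y < s"
          using fwd_jump_le[of s T x] y by simp
      qed (use xT y in auto)
      then show "\<bar>G y - g x\<bar> \<le> 0"
        by (simp add: G_def)
    qed auto
    then show ?thesis
      using cont xT unfolding has_delta_derivative_scattered[OF xT less]
      by (simp add: continuous_on_eq_continuous_within)
  qed
  moreover have "F a = 0"
    by (simp add: F_def)
  ultimately show ?thesis
    using cont by blast
qed

section \<open>The delta integral as a function of its upper limit\<close>

lemma delta_antiderivativeI:
  assumes "r \<in> T" "s \<in> T" "continuous_on T F"
    and "\<And>x. x \<in> T \<Longrightarrow> x < s \<Longrightarrow> has_delta_derivative T F (g x) x"
  shows "delta_antiderivative T r s g F"
  unfolding delta_antiderivative_def Let_def
proof
  show "continuous_on (T \<inter> {r..s}) F"
    using assms(3) by (rule continuous_on_subset) auto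
  show "\<forall>x\<in>T \<inter> {r..s} - {s}. has_delta_derivative (T \<inter> {r..s}) F (g x) x"
    using assms by (auto intro!: has_delta_derivative_restrict)
qed

lemma delta_integral_a: "delta_integral T a a g = 0"
proof -
  have "delta_antiderivative T a a g (\<lambda>_. 0)"
    by (auto simp: delta_antiderivative_def Let_def)
  from delta_integral_eq[OF closed a_in a_in _ this] show ?thesis
    by simp
qed

lemma delta_integral_properties:
  assumes g: "rd_continuous_on T (ts_kappa T) g"
  shows "continuous_on T (\<lambda>t. delta_integral T a t g)" (is ?A)
    and "\<And>x. x \<in> ts_kappa T \<Longrightarrow> has_delta_derivative T (\<lambda>t. delta_integral T a t g) (g x) x"
proof -
  obtain F where F: "continuous_on T F" "F a = 0"
    "\<And>x. x \<in> ts_kappa T \<Longrightarrow> has_delta_derivative T F (g x) x"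
    using ex_delta_antiderivative[OF g] by blast
  have eq: "delta_integral T a t g = F t" if t: "t \<in> T" for t
  proof -
    have "delta_antiderivative T a t g F"
      using F t le_b[OF t] by (intro delta_antiderivativeI a_in) (auto intro!: F(3) kappaI)
    then show ?thesis
      using delta_integral_eq[OF closed a_in t ge_a[OF t]] F(2) by simp
  qed
  show ?A
    using F(1) eq by (simp cong: continuous_on_cong)
  fix x assume x: "x \<in> ts_kappa T"
  show "has_delta_derivative T (\<lambda>t. delta_integral T a t g) (g x) x"
    using has_delta_derivative_cong[of T "\<lambda>t. delta_integral T a t g" F x] eq F(3)[OF x]
      kappaD[OF x] fwd_in by simp
qed

lemmas continuous_on_delta_integral = delta_integral_properties(1)
lemmas has_delta_derivative_delta_integral = delta_integral_properties(2)

lemma delta_antiderivative_delta_integral: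
  assumes "rd_continuous_on T (ts_kappa T) g" "r \<in> T" "s \<in> T"
  shows "delta_antiderivative T r s g (\<lambda>t. delta_integral T a t g)"
proof (rule delta_antiderivativeI[OF assms(2,3) continuous_on_delta_integral[OF assms(1)]])
  fix x assume "x \<in> T" "x < s"
  then show "has_delta_derivative T (\<lambda>t. delta_integral T a t g) (g x) x"
    using le_b[OF assms(3)] by (intro has_delta_derivative_delta_integral assms kappaI) auto
qed

lemma delta_integral_mono:
  assumes "rd_continuous_on T (ts_kappa T) g" "rd_continuous_on T (ts_kappa T) k" "s \<in> T"
    and "\<And>x. x \<in> T \<Longrightarrow> x < s \<Longrightarrow> g x \<le> k x"
  shows "delta_integral T a s g \<le> delta_integral T a s k"
  using delta_antiderivative_diff_le[OF closed a_in assms(3) ge_a[OF assms(3)]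
      delta_antiderivative_delta_integral[OF assms(1) a_in assms(3)]
      delta_antiderivative_delta_integral[OF assms(2) a_in assms(3)]] assms(4)
  by (simp add: delta_integral_a)

lemma delta_integral_mono_limit:
  assumes "rd_continuous_on T (ts_kappa T) g" "r \<in> T" "s \<in> T" "r \<le> s"
    and "\<And>x. x \<in> ts_kappa T \<Longrightarrow> 0 \<le> g x"
  shows "delta_integral T a r g \<le> delta_integral T a s g"
proof -
  have "delta_antiderivative T r s (\<lambda>_. 0) (\<lambda>_. 0)"
    by (auto simp: delta_antiderivative_def Let_def has_delta_derivative_const)
  from delta_antiderivative_diff_le[OF closed assms(2-4) this
      delta_antiderivative_delta_integral[OF assms(1-3)]]
  show ?thesis
    using assms(5) kappaI le_b[OF assms(3)] by force
qed

lemma delta_integral_nonneg: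
  assumes "rd_continuous_on T (ts_kappa T) g" "s \<in> T" "\<And>x. x \<in> ts_kappa T \<Longrightarrow> 0 \<le> g x"
  shows "0 \<le> delta_integral T a s g"
  using delta_integral_mono_limit[OF assms(1) a_in assms(2) ge_a[OF assms(2)] assms(3)]
  by (simp add: delta_integral_a)

lemma delta_integral_cmult:
  assumes "rd_continuous_on T (ts_kappa T) g" "s \<in> T"
  shows "delta_integral T a s (\<lambda>x. c * g x) = c * delta_integral T a s g"
proof -
  have "delta_antiderivative T a s (\<lambda>x. c * g x) (\<lambda>t. c * delta_integral T a t g)"
    using le_b[OF assms(2)]
    by (intro delta_antiderivativeI a_in assms continuous_intros continuous_on_delta_integral
        has_delta_derivative_cmult has_delta_derivative_delta_integral kappaI) auto
  from delta_integral_eq[OF closed a_in assms(2) ge_a[OF assms(2)] this] show ?thesis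
    by (simp add: delta_integral_a)
qed

lemma delta_integral_add:
  assumes "rd_continuous_on T (ts_kappa T) g" "rd_continuous_on T (ts_kappa T) k" "s \<in> T"
  shows "delta_integral T a s (\<lambda>x. g x + k x) = delta_integral T a s g + delta_integral T a s k"
proof -
  have "delta_antiderivative T a s (\<lambda>x. g x + k x)
      (\<lambda>t. delta_integral T a t g + delta_integral T a t k)"
    using le_b[OF assms(3)]
    by (intro delta_antiderivativeI a_in assms continuous_intros continuous_on_delta_integral
        has_delta_derivative_add has_delta_derivative_delta_integral kappaI) auto
  from delta_integral_eq[OF closed a_in assms(3) ge_a[OF assms(3)] this] show ?thesis
    by (simp add: delta_integral_a)
qed

end

section \<open>Existence of the exponential function\<close>

lemma DERIV_exp_chain:
  "(g has_real_derivative L) (at x within S) \<Longrightarrow>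
   ((\<lambda>t. exp (g t)) has_real_derivative (L * exp (g x))) (at x within S)"
  by (auto intro!: derivative_eq_intros)

context bounded_time_scale
begin

text \<open>The only point that \<open>ts_kappa T\<close> can lack is a left-scattered
  \<open>b\<close>. It is isolated, so continuity there is automatic.\<close>

lemma delta_differentiable_imp_continuous_on:
  assumes "\<And>x. x \<in> ts_kappa T \<Longrightarrow> has_delta_derivative T y (L x) x"
  shows "continuous_on T y"
  unfolding continuous_on_eq_continuous_within
proof
  fix x assume x: "x \<in> T"
  show "continuous (at x within T) y"
  proof (cases "x \<in> ts_kappa T")
    case True
    then show ?thesis
      using has_delta_derivative_imp_continuous x assms by blast
  next
    case False
    then have "x = b" and "bwd_jump T b < b"
      using x kappaI[OF x] le_b[OF x] b_kappa bwd_jump_le[of T b] by fastforce+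
    moreover have "\<bar>y s - y b\<bar> < e" if s: "s \<in> T" "\<bar>s - b\<bar> < b - bwd_jump T b" and "0 < e" for s e
    proof -
      have "s = b"
        using s bwd_jump_ge[of s T b] le_b[of s] by force
      with \<open>0 < e\<close> show ?thesis by simp
    qed
    ultimately show ?thesis
      unfolding continuous_within_eps_delta dist_real_def
      by (intro allI impI exI[of _ "b - bwd_jump T b"]) auto
  qed
qed

text \<open>From the left of \<open>x\<close> a forward jump cannot pass \<open>x\<close>. From a
  point between \<open>x\<close> and a nearby \<open>s\<close> in \<open>T\<close> it cannot pass
  \<open>s\<close>; such an \<open>s\<close> exists by right-density unless
  \<open>x = b\<close>.\<close>

lemma graininess_small:
  assumes x: "x \<in> T" "fwd_jump T x = x" and e: "0 < e"
  shows "\<exists>d>0. \<forall>y\<in>T. \<bar>y - x\<bar> < d \<longrightarrow> fwd_jump T y - y < e"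
proof -
  have left: "fwd_jump T y - y < e" if "y \<in> T" "y < x" "\<bar>y - x\<bar> < e" for y
    using fwd_jump_le[OF x(1) that(2)] that by simp
  show ?thesis
  proof (cases "x < b")
    case False
    have "fwd_jump T y - y < e" if "y \<in> T" "\<bar>y - x\<bar> < e" for y
      using left[of y] that False le_b[of y] x e by (cases "y = x") auto
    then show ?thesis
      using e by blast
  next
    case True
    obtain s where s: "s \<in> T" "x < s" "s < x + e"
      using fwd_jump_dense[OF b_in True x(2), of "x + e"] e by auto
    have "fwd_jump T y - y < e" if y: "y \<in> T" "\<bar>y - x\<bar> < min e (s - x)" for y
    proof (cases y x rule: linorder_cases)
      case less
      then show ?thesis using left y by auto
    next
      case equal
      then show ?thesis using x e by simp
    next
      case greater
      then show ?thesis using fwd_jump_le[OF s(1), of y] s y by auto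
    qed
    then show ?thesis
      using e s by (intro exI[of _ "min e (s - x)"]) auto
  qed
qed

lemma tendsto_graininess_dense:
  assumes x: "x \<in> T" "fwd_jump T x = x"
  shows "((\<lambda>y. fwd_jump T y - y) \<longlongrightarrow> 0) (at x within ts_kappa T)"
  unfolding Lim_within dist_real_def
proof (intro allI impI)
  fix e :: real assume "0 < e"
  then obtain d where "d > 0" "\<forall>y\<in>T. \<bar>y - x\<bar> < d \<longrightarrow> fwd_jump T y - y < e"
    using graininess_small[OF x] by blast
  then show "\<exists>d>0. \<forall>y\<in>ts_kappa T. 0 < \<bar>y - x\<bar> \<and> \<bar>y - x\<bar> < d \<longrightarrow> \<bar>fwd_jump T y - y - 0\<bar> < e"
    using kappaD fwd_jump_ge by (intro exI[of _ d]) auto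
qed

lemma tendsto_graininess_left:
  assumes x: "x \<in> T"
  shows "((\<lambda>y. fwd_jump T y - y) \<longlongrightarrow> 0) (at x within ts_kappa T \<inter> {..<x})"
  unfolding Lim_within dist_real_def
proof (intro allI impI)
  fix e :: real assume "0 < e"
  moreover have "\<bar>fwd_jump T y - y\<bar> < e" if "y < x" "\<bar>y - x\<bar> < e" for y
    using fwd_jump_le[OF x that(1)] that fwd_jump_ge[of y T] by simp
  ultimately show "\<exists>d>0. \<forall>y\<in>ts_kappa T \<inter> {..<x}. 0 < \<bar>y - x\<bar> \<and> \<bar>y - x\<bar> < d \<longrightarrow>
      \<bar>fwd_jump T y - y - 0\<bar> < e"
    by (intro exI[of _ e]) auto
qed

text \<open>Hilger's cylinder transformation. It is chosen so that its integral over a gap of length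
  \<open>m\<close> starting at \<open>x\<close> is the logarithm of the growth factor
  \<open>1 + m * f x\<close>.\<close>

definition cylinder :: "(real \<Rightarrow> real) \<Rightarrow> real \<Rightarrow> real" where
  "cylinder f x = (if fwd_jump T x = x then f x
     else ln (1 + (fwd_jump T x - x) * f x) / (fwd_jump T x - x))"

text \<open>The bounds \<open>z - z\<^sup>2 \<le> ln (1 + z) \<le> z\<close>, with \<open>z\<close>
  the product of graininess and \<open>f x\<close>, are divided by the graininess. Where
  \<open>f\<close> stays bounded, \<open>cylinder f - f\<close> thus vanishes with the
  graininess.\<close>

lemma cylinder_bound:
  assumes "0 \<le> f x"
  shows "\<bar>cylinder f x - f x\<bar> \<le> (fwd_jump T x - x) * (f x)\<^sup>2"
proof (cases "fwd_jump T x = x")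
  case True
  then show ?thesis by (simp add: cylinder_def)
next
  case False
  define m where "m = fwd_jump T x - x"
  have m: "m > 0"
    using False fwd_jump_ge[of x T] by (simp add: m_def)
  define z where "z = m * f x"
  have z: "z \<ge> 0"
    using assms m by (simp add: z_def)
  have "z - z\<^sup>2 \<le> ln (1 + z)"
  proof (cases "z \<le> 1")
    case True
    then show ?thesis using ln_one_plus_pos_lower_bound z by blast
  next
    case False
    then have "z - z\<^sup>2 \<le> 0"
      by (simp add: power2_eq_square)
    also have "0 \<le> ln (1 + z)"
      using z by simp
    finally show ?thesis .
  qed
  moreover have "ln (1 + z) \<le> z"
    using z by (rule ln_add_one_self_le_self)
  ultimately have "\<bar>ln (1 + z) - z\<bar> \<le> z\<^sup>2"
    by simp
  then have "\<bar>ln (1 + z) - z\<bar> / m \<le> z\<^sup>2 / m"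
    using m by (intro divide_right_mono) auto
  also have "z\<^sup>2 / m = m * (f x)\<^sup>2"
    using m by (simp add: z_def power2_eq_square)
  also have "\<bar>ln (1 + z) - z\<bar> / m = \<bar>cylinder f x - f x\<bar>"
  proof -
    have "cylinder f x - f x = (ln (1 + z) - z) / m"
      using m False by (simp add: cylinder_def z_def m_def[symmetric] diff_divide_distrib)
    then show ?thesis
      using m by simp
  qed
  finally show ?thesis
    by (simp add: m_def)
qed

text \<open>The difference \<open>cylinder f - f\<close> tends to 0 at right-dense points and from
  the left at left-dense points, because the graininess does and \<open>f\<close> has a limit there.
  So rd-continuity passes on from \<open>f\<close>.\<close>

lemma rd_continuous_cylinder:
  assumes f: "rd_continuous_on T (ts_kappa T) f" "\<And>x. x \<in> ts_kappa T \<Longrightarrow> 0 \<le> f x"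
  shows "rd_continuous_on T (ts_kappa T) (cylinder f)"
proof -
  define k where "k = (\<lambda>x. cylinder f x - f x)"
  have lim: "(k \<longlongrightarrow> 0) (at t within D)"
    if D: "D \<subseteq> ts_kappa T" and m: "((\<lambda>y. fwd_jump T y - y) \<longlongrightarrow> 0) (at t within D)"
      and l: "(f \<longlongrightarrow> l) (at t within D)" for D t l
  proof (rule Lim_null_comparison)
    show "\<forall>\<^sub>F y in at t within D. norm (k y) \<le> (fwd_jump T y - y) * (f y)\<^sup>2"
      unfolding eventually_at_filter k_def
      using D f(2) cylinder_bound by (intro always_eventually) auto
    show "((\<lambda>y. (fwd_jump T y - y) * (f y)\<^sup>2) \<longlongrightarrow> 0) (at t within D)"
      using tendsto_mult[OF m tendsto_power[OF l, of 2]] by simp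
  qed
  have "rd_continuous_on T (ts_kappa T) k"
    unfolding rd_continuous_on_def
  proof (intro conjI ballI impI)
    fix t assume t: "t \<in> ts_kappa T" "fwd_jump T t = t"
    then have "(f \<longlongrightarrow> f t) (at t within ts_kappa T)"
      using f(1) unfolding rd_continuous_on_def continuous_within by blast
    then have "(k \<longlongrightarrow> 0) (at t within ts_kappa T)"
      using t by (intro lim tendsto_graininess_dense kappaD) auto
    moreover have "k t = 0"
      using t by (simp add: k_def cylinder_def)
    ultimately show "continuous (at t within ts_kappa T) k"
      by (simp add: continuous_within)
  next
    fix t assume t: "t \<in> ts_kappa T" "bwd_jump T t = t"
    then obtain l where "(f \<longlongrightarrow> l) (at t within ts_kappa T \<inter> {..<t})"
      using f(1) unfolding rd_continuous_on_def by blast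
    then have "(k \<longlongrightarrow> 0) (at t within ts_kappa T \<inter> {..<t})"
      using t by (intro lim tendsto_graininess_left kappaD) auto
    then show "\<exists>l. (k \<longlongrightarrow> l) (at t within ts_kappa T \<inter> {..<t})" ..
  qed
  from rd_continuous_on_add[OF this f(1)] show ?thesis
    by (simp add: k_def)
qed

text \<open>The exponential of the integral of \<open>cylinder f\<close> is the solution: by the
  chain rule at right-dense points, and across a gap because it is multiplied by exactly the growth
  factor.\<close>

lemma ex_exponential:
  assumes f: "rd_continuous_on T (ts_kappa T) f" "\<And>x. x \<in> ts_kappa T \<Longrightarrow> 0 \<le> f x"
  shows "\<exists>E. E a = 1 \<and> (\<forall>x. 0 < E x) \<and>
    (\<forall>x\<in>ts_kappa T. has_delta_derivative T E (f x * E x) x)"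
proof -
  define C where "C = (\<lambda>t. delta_integral T a t (cylinder f))"
  note rd = rd_continuous_cylinder[OF f]
  have "has_delta_derivative T (\<lambda>t. exp (C t)) (f x * exp (C x)) x" if x: "x \<in> ts_kappa T" for x
  proof -
    have D: "has_delta_derivative T C (cylinder f x) x"
      unfolding C_def by (rule has_delta_derivative_delta_integral[OF rd x])
    show ?thesis
    proof (cases "fwd_jump T x = x")
      case True
      then show ?thesis
        using D DERIV_exp_chain by (auto simp: has_delta_derivative_dense cylinder_def)
    next
      case False
      define m where "m = fwd_jump T x - x"
      have m: "m > 0"
        using False fwd_jump_ge[of x T] by (simp add: m_def)
      have xT: "x \<in> T"
        using x by (rule kappaD)
      have less: "x < fwd_jump T x"
        using m by (simp add: m_def)
      have C: "continuous (at x within T) C" "C (fwd_jump T x) - C x = cylinder f x * m"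
        using D unfolding has_delta_derivative_scattered[OF xT less] m_def by auto
      have "cylinder f x * m = ln (1 + m * f x)"
        using False m by (simp add: cylinder_def m_def)
      then have "C (fwd_jump T x) = C x + ln (1 + m * f x)"
        using C(2) by simp
      moreover have "1 + m * f x > 0"
        using f(2)[OF x] m by (simp add: add_pos_nonneg)
      ultimately have "exp (C (fwd_jump T x)) = exp (C x) * (1 + m * f x)"
        by (simp add: exp_add)
      then show ?thesis
        using C(1) unfolding has_delta_derivative_scattered[OF xT less] m_def[symmetric]
        by (auto simp: algebra_simps intro: continuous_exp)
    qed
  qed
  moreover have "exp (C a) = 1"
    by (simp add: C_def delta_integral_a)
  ultimately show ?thesis
    by (intro exI[of _ "\<lambda>t. exp (C t)"]) auto
qed

end

section \<open>Comparison with the exponential function and Gronwall's inequality\<close>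

locale ts_exponential = bounded_time_scale +
  fixes f E :: "real \<Rightarrow> real"
  assumes f_nonneg: "x \<in> ts_kappa T \<Longrightarrow> 0 \<le> f x"
    and E_a: "E a = 1" and E_pos: "0 < E x"
    and E_deriv: "x \<in> ts_kappa T \<Longrightarrow> has_delta_derivative T E (f x * E x) x"
begin

lemma continuous_on_E: "continuous_on T E"
  by (rule delta_differentiable_imp_continuous_on[OF E_deriv])

lemma E_fwd:
  assumes "x \<in> ts_kappa T" "x < fwd_jump T x"
  shows "E (fwd_jump T x) = E x * (1 + f x * (fwd_jump T x - x))"
  using E_deriv[OF assms(1)] assms kappaD by (auto simp: has_delta_derivative_scattered algebra_simps)

text \<open>The quotient \<open>y / E\<close> is nonincreasing: by the quotient rule at right-dense
  points, and across a gap because \<open>E\<close> is multiplied by \<open>1 + f x * m\<close>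
  while \<open>y\<close> ends at most at \<open>y x\<close> times that factor. Uniqueness of
  solutions and Gronwall's inequality are both instances.\<close>

lemma exponential_comparison:
  assumes rs: "r \<in> T" "s \<in> T" "r \<le> s"
    and y: "continuous_on T y" "\<And>x. x \<in> T \<Longrightarrow> x < s \<Longrightarrow> has_delta_derivative T y (y' x) x"
    and le: "\<And>x. x \<in> T \<Longrightarrow> x < s \<Longrightarrow> y' x \<le> f x * y x"
  shows "y s / E s \<le> y r / E r"
proof -
  have kappa: "x \<in> ts_kappa T" if "x \<in> T" "x < s" for x
    using that le_b[OF rs(2)] by (intro kappaI) auto
  have "- (y r / E r) \<le> - (y s / E s)"
  proof (rule time_scale_mono[OF closed rs])
    have "continuous_on T (\<lambda>x. - (y x / E x))"
      using E_pos by (intro continuous_intros y(1) continuous_on_E) (auto simp: less_imp_neq[symmetric])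
    then show "continuous_on (T \<inter> {r..s}) (\<lambda>x. - (y x / E x))"
      by (rule continuous_on_subset) auto
  next
    fix x assume x: "x \<in> T" "r \<le> x" "x < s" "fwd_jump T x = x"
    have "(y has_real_derivative y' x) (at x within T)"
      "(E has_real_derivative f x * E x) (at x within T)"
      using y(2)[OF x(1,3)] E_deriv[OF kappa[OF x(1,3)]] x(4)
      by (auto simp: has_delta_derivative_dense)
    then have "((\<lambda>x. - (y x / E x)) has_real_derivative
        - ((y' x * E x - y x * (f x * E x)) / (E x * E x))) (at x within T)"
      using E_pos[of x] by (intro DERIV_minus DERIV_divide) auto
    moreover have "y' x * E x \<le> (f x * y x) * E x"
      using le[OF x(1,3)] E_pos[of x] by (intro mult_right_mono) auto
    then have "0 \<le> - ((y' x * E x - y x * (f x * E x)) / (E x * E x))"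
      using E_pos[of x] by (simp add: divide_nonpos_pos algebra_simps)
    ultimately show "\<exists>L\<ge>0. ((\<lambda>x. - (y x / E x)) has_real_derivative L) (at x within T)"
      by blast
  next
    fix x assume x: "x \<in> T" "r \<le> x" "x < s" "x < fwd_jump T x"
    define m where "m = fwd_jump T x - x"
    have m: "m > 0"
      using x by (simp add: m_def)
    have pos: "0 < 1 + f x * m"
      using f_nonneg[OF kappa[OF x(1,3)]] m by (simp add: add_pos_nonneg)
    have "y (fwd_jump T x) = y x + y' x * m"
      using y(2)[OF x(1,3)] x by (auto simp: has_delta_derivative_scattered m_def)
    also have "\<dots> \<le> y x + f x * y x * m"
      using le[OF x(1,3)] m by (intro add_left_mono mult_right_mono) auto
    also have "\<dots> = y x * (1 + f x * m)"
      by (simp add: algebra_simps)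
    finally have "y (fwd_jump T x) / E (fwd_jump T x) \<le> y x * (1 + f x * m) / E (fwd_jump T x)"
      using E_pos[of "fwd_jump T x"] by (intro divide_right_mono) auto
    also have "\<dots> = y x / E x"
      using E_fwd[OF kappa[OF x(1,3)] x(4)] pos unfolding m_def[symmetric] by simp
    finally show "- (y x / E x) \<le> - (y (fwd_jump T x) / E (fwd_jump T x))"
      by simp
  qed
  then show ?thesis by simp
qed

text \<open>\<open>E\<close> divided by \<open>E r\<close> is a solution. For any solution
  \<open>y\<close> the comparison applies to \<open>y\<close> and to its negative, as both satisfy
  the differential inequality with equality. It runs forward in time, hence
  \<open>r \<le> t\<close>.\<close>

lemma ts_exp_eq:
  assumes rt: "r \<in> T" "t \<in> T" "r \<le> t"
  shows "ts_exp T f t r = E t / E r"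
  unfolding ts_exp_def
proof (rule the_equality)
  have "has_delta_derivative T (\<lambda>x. (1 / E r) * E x) ((1 / E r) * (f x * E x)) x"
    if "x \<in> ts_kappa T" for x
    using that by (intro has_delta_derivative_cmult E_deriv kappaD)
  then show "\<exists>y. (\<forall>x\<in>ts_kappa T. has_delta_derivative T y (f x * y x) x) \<and> y r = 1 \<and> E t / E r = y t"
    using E_pos[of r] by (intro exI[of _ "\<lambda>x. (1 / E r) * E x"]) (auto simp: field_simps)
next
  fix v assume "\<exists>y. (\<forall>x\<in>ts_kappa T. has_delta_derivative T y (f x * y x) x) \<and> y r = 1 \<and> v = y t"
  then obtain y where y: "\<And>x. x \<in> ts_kappa T \<Longrightarrow> has_delta_derivative T y (f x * y x) x"
    and yr: "y r = 1" and v: "v = y t"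
    by blast
  have y_minus: "has_delta_derivative T (\<lambda>x. (-1) * y x) ((-1) * (f x * y x)) x" if "x \<in> ts_kappa T" for x
    using that by (intro has_delta_derivative_cmult y kappaD)
  have kappa: "x \<in> ts_kappa T" if "x \<in> T" "x < t" for x
    using that le_b[OF rt(2)] by (intro kappaI) auto
  have cont: "continuous_on T y"
    by (rule delta_differentiable_imp_continuous_on[OF y])
  have "y t / E t \<le> y r / E r"
    by (rule exponential_comparison[OF rt cont y]) (auto intro: kappa)
  moreover have "(-1) * y t / E t \<le> (-1) * y r / E r"
    by (rule exponential_comparison[OF rt _ y_minus]) (auto intro: kappa continuous_intros cont)
  ultimately have "y t / E t = 1 / E r"
    using yr by simp
  then show "v = E t / E r"
    using v E_pos[of t] E_pos[of r] by (simp add: field_simps)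
qed

lemma E_eq_integral:
  assumes t: "t \<in> T"
  shows "1 + delta_integral T a t (\<lambda>s. f s * ts_exp T f t (fwd_jump T s)) = E t"
proof -
  \<comment> \<open>Here \<open>t\<close> is fixed. The time scale quotient rule for the reciprocal
    of \<open>E\<close> has the denominator \<open>E x * E (fwd_jump T x)\<close>, which is where
    the forward jump in the exponential comes from.\<close>
  have "delta_antiderivative T a t (\<lambda>s. f s * (E t / E (fwd_jump T s))) (\<lambda>x. - E t / E x)"
  proof (rule delta_antiderivativeI[OF a_in t])
    show "continuous_on T (\<lambda>x. - E t / E x)"
      using E_pos by (intro continuous_intros continuous_on_E) (auto simp: less_imp_neq[symmetric])
    fix x assume x: "x \<in> T" "x < t"
    have kappa: "x \<in> ts_kappa T"
      using x le_b[OF t] by (intro kappaI) auto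
    note D = E_deriv[OF kappa]
    show "has_delta_derivative T (\<lambda>x. - E t / E x) (f x * (E t / E (fwd_jump T x))) x"
    proof (cases "fwd_jump T x = x")
      case True
      then have "(E has_real_derivative f x * E x) (at x within T)"
        using D by (simp add: has_delta_derivative_dense)
      then have "((\<lambda>x. - E t / E x) has_real_derivative
          (0 * E x - (- E t) * (f x * E x)) / (E x * E x)) (at x within T)"
        using E_pos[of x] by (intro DERIV_divide DERIV_const) auto
      moreover have "(0 * E x - (- E t) * (f x * E x)) / (E x * E x) = f x * (E t / E x)"
        using E_pos[of x] by simp
      ultimately show ?thesis
        using True by (simp add: has_delta_derivative_dense)
    next
      case False
      then have less: "x < fwd_jump T x"
        using fwd_jump_ge[of x T] by simp
      have "continuous (at x within T) E"
        using continuous_on_E x by (simp add: continuous_on_eq_continuous_within)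
      then have "continuous (at x within T) (\<lambda>x. - E t / E x)"
        using E_pos[of x] by (intro continuous_intros) auto
      moreover have "- E t / E (fwd_jump T x) - (- E t / E x) =
          f x * (E t / E (fwd_jump T x)) * (fwd_jump T x - x)"
      proof -
        have "- E t / E (fwd_jump T x) - (- E t / E x) =
            E t / E (fwd_jump T x) * (E (fwd_jump T x) / E x - 1)"
          using E_pos[of x] E_pos[of "fwd_jump T x"] by (simp add: field_simps)
        also have "E (fwd_jump T x) / E x - 1 = f x * (fwd_jump T x - x)"
          using E_fwd[OF kappa less] E_pos[of x] by simp
        finally show ?thesis
          by simp
      qed
      ultimately show ?thesis
        unfolding has_delta_derivative_scattered[OF x(1) less] by blast
    qed
  qed
  then have "delta_integral T a t (\<lambda>s. f s * (E t / E (fwd_jump T s))) = - E t / E t - (- E t / E a)"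
    by (rule delta_integral_eq[OF closed a_in t ge_a[OF t]])
  also have "\<dots> = E t - 1"
    using E_pos[of t] by (simp add: E_a)
  finally show ?thesis
    using delta_integral_cong[OF ge_a[OF t], of T
        "\<lambda>s. f s * ts_exp T f t (fwd_jump T s)" "\<lambda>s. f s * (E t / E (fwd_jump T s))"]
      fwd_in fwd_jump_le[OF t] t by (simp add: ts_exp_eq)
qed

text \<open>The majorant \<open>y\<close> of \<open>u\<close> has delta derivative
  \<open>f x * u x\<close>, which is at most \<open>f x * y x\<close>, so the comparison with
  \<open>E\<close> applies to it.\<close>

lemma gronwall:
  assumes rd: "rd_continuous_on T (ts_kappa T) (\<lambda>x. f x * u x)" and t: "t \<in> T"
    and le: "\<And>s. s \<in> T \<Longrightarrow> s \<le> t \<Longrightarrow> u s \<le> c + delta_integral T a s (\<lambda>x. f x * u x)"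
  shows "u t \<le> c * E t"
proof -
  define y where "y = (\<lambda>s. c + delta_integral T a s (\<lambda>x. f x * u x))"
  have kappa: "x \<in> ts_kappa T" if "x \<in> T" "x < t" for x
    using that le_b[OF t] by (intro kappaI) auto
  have "y t / E t \<le> y a / E a"
  proof (rule exponential_comparison[OF a_in t ge_a[OF t], where y' = "\<lambda>x. f x * u x"])
    show "continuous_on T y"
      unfolding y_def by (intro continuous_intros continuous_on_delta_integral[OF rd])
    fix x assume x: "x \<in> T" "x < t"
    from has_delta_derivative_add[OF x(1) has_delta_derivative_const[of T c] has_delta_derivative_delta_integral[OF rd kappa[OF x]]]
    show "has_delta_derivative T y (f x * u x) x"
      by (simp add: y_def)
    show "f x * u x \<le> f x * y x"
      using le[of x] x f_nonneg[OF kappa[OF x]] unfolding y_def by (intro mult_left_mono) auto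
  qed
  then have "y t \<le> c * E t"
    using E_pos[of t] by (simp add: E_a y_def delta_integral_a pos_divide_le_eq)
  then show ?thesis
    using le[OF t] by (simp add: y_def)
qed

end

section \<open>The Bihari function and its inverse\<close>

locale bihari_primitive =
  fixes w \<Psi> :: "real \<Rightarrow> real" and x0 :: real
  assumes w_cont: "continuous_on {0<..} w" and w_pos: "0 < x \<Longrightarrow> 0 < w x"
    and w_mono: "0 < x \<Longrightarrow> x \<le> y \<Longrightarrow> w x \<le> w y" and x0: "0 < x0"
    and \<Psi>_eq: "\<Psi> = (\<lambda>x. LBINT s=ereal x0..ereal x. 1 / w s)"
begin

lemma \<Psi>_deriv:
  assumes x: "0 < x"
  shows "(\<Psi> has_real_derivative 1 / w x) (at x)"
proof -
  \<comment> \<open>This compact interval avoids 0, where \<open>1 / w\<close> may be singular,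
    contains \<open>x0\<close> and has \<open>x\<close> in its interior, so the fundamental theorem
    gives a two-sided derivative at \<open>x\<close>.\<close>
  define l r where "l = min x0 x / 2" and "r = max x0 x + 1"
  have lr: "0 < l" "l < x" "x < r" "l \<le> x0" "x0 \<le> r"
    using x x0 by (auto simp: l_def r_def)
  have "continuous_on {l..r} (\<lambda>s. 1 / w s)"
    using lr w_pos by (intro continuous_intros continuous_on_subset[OF w_cont])
      (auto simp: less_imp_neq[symmetric])
  then have "(\<Psi> has_vector_derivative 1 / w x) (at x within {l..r})"
    unfolding \<Psi>_eq using lr by (intro interval_integral_FTC2) auto
  then show ?thesis
    using lr by (simp add: at_within_Icc_at has_real_derivative_iff_has_vector_derivative)
qed

lemma \<Psi>_strict_mono:
  assumes "0 < x" "x < y"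
  shows "\<Psi> x < \<Psi> y"
  using assms(2)
proof (rule DERIV_pos_imp_increasing)
  fix z assume "x \<le> z" "z \<le> y"
  then show "\<exists>d. (\<Psi> has_real_derivative d) (at z) \<and> 0 < d"
    using \<Psi>_deriv[of z] w_pos[of z] assms by (intro exI[of _ "1 / w z"]) auto
qed

lemma \<Psi>_le_iff: "0 < x \<Longrightarrow> 0 < y \<Longrightarrow> \<Psi> x \<le> \<Psi> y \<longleftrightarrow> x \<le> y"
  using \<Psi>_strict_mono[of x y] \<Psi>_strict_mono[of y x] by (cases x y rule: linorder_cases) auto

lemma inj_on_\<Psi>: "inj_on \<Psi> {0<..}"
proof (rule inj_onI)
  fix x y assume "x \<in> {0<..}" "y \<in> {0<..}" "\<Psi> x = \<Psi> y"
  then show "x = y"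
    using \<Psi>_le_iff[of x y] \<Psi>_le_iff[of y x] by auto
qed

lemma continuous_on_\<Psi>: "continuous_on {0<..} \<Psi>"
  using \<Psi>_deriv by (intro DERIV_continuous_on) (auto intro: has_field_derivative_at_within)

text \<open>By the mean value theorem, since the slope \<open>1 / w\<close> is largest at the left
  end. This replaces the chain rule across gaps.\<close>

lemma \<Psi>_increment:
  assumes "0 < x" "x \<le> y"
  shows "\<Psi> y - \<Psi> x \<le> (y - x) / w x"
proof (cases "x = y")
  case False
  then have "x < y"
    using assms by simp
  moreover have "(\<Psi> has_real_derivative 1 / w z) (at z)" if "x \<le> z" "z \<le> y" for z
    using that assms by (intro \<Psi>_deriv) auto
  ultimately obtain z where z: "x < z" "z < y" "\<Psi> y - \<Psi> x = (y - x) * (1 / w z)"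
    using MVT2[of x y \<Psi> "\<lambda>z. 1 / w z"] by blast
  have "(y - x) * (1 / w z) \<le> (y - x) * (1 / w x)"
    using z w_mono[of x z] w_pos[of x] assms by (intro mult_left_mono frac_le) auto
  with z show ?thesis by simp
qed simp

lemma \<Psi>_range_between:
  assumes "0 < p" "0 < q" "\<Psi> p \<le> v" "v \<le> \<Psi> q"
  shows "v \<in> \<Psi> ` {p..q}"
proof -
  have "p \<le> q"
    using assms \<Psi>_le_iff[of p q] by simp
  moreover have "continuous_on {p..q} \<Psi>"
    using assms by (intro continuous_on_subset[OF continuous_on_\<Psi>]) auto
  ultimately show ?thesis
    using IVT'[of \<Psi> p v q] assms by auto
qed

lemma continuous_on_\<Psi>_inv:
  assumes "0 < p" "0 < q"
  shows "continuous_on {\<Psi> p..\<Psi> q} (inv_into {0<..} \<Psi>)"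
proof (rule continuous_on_subset)
  show "continuous_on (\<Psi> ` {p..q}) (inv_into {0<..} \<Psi>)"
    using assms inj_on_\<Psi> by (intro continuous_on_inv continuous_on_subset[OF continuous_on_\<Psi>]) auto
  show "{\<Psi> p..\<Psi> q} \<subseteq> \<Psi> ` {p..q}"
    using \<Psi>_range_between[OF assms] by auto
qed

lemma \<Psi>_inv:
  assumes "v \<in> \<Psi> ` {0<..}"
  shows "0 < inv_into {0<..} \<Psi> v" "\<Psi> (inv_into {0<..} \<Psi> v) = v"
  using inv_into_into[OF assms] f_inv_into_f[OF assms] by auto

end

text \<open>With \<open>K\<close> the integral of \<open>k\<close>, the difference of
  \<open>K\<close> and \<open>\<Psi>\<close> along \<open>R\<close> is nondecreasing, because
  \<open>r x / w (R x) \<le> k x\<close>. At right-dense points this is the chain rule, across gaps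
  it is \<open>\<Psi>_increment\<close>, where \<open>r x \<ge> 0\<close> keeps \<open>R\<close>
  from decreasing.\<close>

lemma (in bounded_time_scale) bihari:
  assumes "bihari_primitive w \<Psi> x0"
    and k: "rd_continuous_on T (ts_kappa T) k" "\<And>x. x \<in> ts_kappa T \<Longrightarrow> 0 \<le> k x" and s: "s \<in> T"
    and R: "continuous_on T R" "\<And>x. x \<in> T \<Longrightarrow> 0 < R x"
    and R': "\<And>x. x \<in> T \<Longrightarrow> x < s \<Longrightarrow> has_delta_derivative T R (r x) x"
    and r: "\<And>x. x \<in> T \<Longrightarrow> x < s \<Longrightarrow> 0 \<le> r x" "\<And>x. x \<in> T \<Longrightarrow> x < s \<Longrightarrow> r x \<le> k x * w (R x)"
  shows "\<Psi> (R s) \<le> \<Psi> (R a) + delta_integral T a s k"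
proof -
  interpret bihari_primitive w \<Psi> x0 by fact
  define K where "K = (\<lambda>t. delta_integral T a t k)"
  have kappa: "x \<in> ts_kappa T" if "x \<in> T" "x < s" for x
    using that le_b[OF s] by (intro kappaI) auto
  have "K a - \<Psi> (R a) \<le> K s - \<Psi> (R s)"
  proof (rule time_scale_mono[OF closed a_in s ge_a[OF s]])
    have "continuous_on T (\<lambda>x. K x - \<Psi> (R x))"
      unfolding K_def using R
      by (intro continuous_intros continuous_on_delta_integral k
          continuous_on_compose2[OF continuous_on_\<Psi>]) auto
    then show "continuous_on (T \<inter> {a..s}) (\<lambda>x. K x - \<Psi> (R x))"
      by (rule continuous_on_subset) auto
  next
    fix x assume x: "x \<in> T" "a \<le> x" "x < s" "fwd_jump T x = x"
    have "(K has_real_derivative k x) (at x within T)"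
      using has_delta_derivative_delta_integral[OF k(1) kappa[OF x(1,3)]] x(4)
      by (simp add: has_delta_derivative_dense K_def)
    moreover have "((\<lambda>x. \<Psi> (R x)) has_real_derivative 1 / w (R x) * r x) (at x within T)"
      using R'[OF x(1,3)] x(4)
      by (intro DERIV_chain2[OF \<Psi>_deriv] R(2) x) (simp add: has_delta_derivative_dense)
    ultimately have "((\<lambda>x. K x - \<Psi> (R x)) has_real_derivative k x - 1 / w (R x) * r x) (at x within T)"
      by (rule DERIV_diff)
    moreover have "0 \<le> k x - 1 / w (R x) * r x"
      using r(2)[OF x(1,3)] w_pos[OF R(2)[OF x(1)]] by (simp add: pos_divide_le_eq)
    ultimately show "\<exists>L\<ge>0. ((\<lambda>x. K x - \<Psi> (R x)) has_real_derivative L) (at x within T)"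
      by blast
  next
    fix x assume x: "x \<in> T" "a \<le> x" "x < s" "x < fwd_jump T x"
    define m where "m = fwd_jump T x - x"
    have m: "m > 0"
      using x by (simp add: m_def)
    have wR: "w (R x) > 0"
      by (intro w_pos R(2) x)
    have Kx: "K (fwd_jump T x) - K x = k x * m"
      using has_delta_derivative_delta_integral[OF k(1) kappa[OF x(1,3)]] x(1,4)
      by (simp add: has_delta_derivative_scattered K_def m_def)
    have Rx: "R (fwd_jump T x) - R x = r x * m"
      using R'[OF x(1,3)] x(1,4) by (simp add: has_delta_derivative_scattered m_def)
    have "0 \<le> r x * m"
      using r(1)[OF x(1,3)] m by simp
    then have "\<Psi> (R (fwd_jump T x)) - \<Psi> (R x) \<le> (R (fwd_jump T x) - R x) / w (R x)"
      using Rx by (intro \<Psi>_increment R(2) x) auto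
    also have "\<dots> \<le> k x * m"
      using r(2)[OF x(1,3)] m wR unfolding Rx
      by (simp add: pos_divide_le_eq mult.commute mult.left_commute)
    finally show "K x - \<Psi> (R x) \<le> K (fwd_jump T x) - \<Psi> (R (fwd_jump T x))"
      using Kx by simp
  qed
  then show ?thesis
    by (simp add: K_def delta_integral_a)
qed

section \<open>The explicit bound for \<open>u\<close>\<close>

theorem theorem2:
  fixes T Ts :: "real set" and a b x0 \<xi> :: real
    and u h f \<alpha> \<beta> p \<Phi> W \<Psi> \<Psi>inv :: "real \<Rightarrow> real"
  assumes "time_scale T" and "a \<in> T" and "b \<in> T" and "a < b"
    and Ts: "Ts = T \<inter> {a..b}"
    and "rd_continuous_on Ts Ts u" and "\<forall>t\<in>Ts. 0 \<le> u t"
    and "rd_continuous_on Ts (ts_kappa Ts) h" and "\<forall>t\<in>ts_kappa Ts. 0 \<le> h t"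
    and "rd_continuous_on Ts (ts_kappa Ts) f" and "\<forall>t\<in>ts_kappa Ts. 0 \<le> f t"
    and "rd_continuous_on Ts (ts_kappa Ts) \<beta>" and "\<forall>t\<in>ts_kappa Ts. 0 \<le> \<beta> t"
    and "\<exists>t\<in>ts_kappa (ts_kappa Ts). \<beta> t \<noteq> 0"
    and "continuous_on {0..} \<Phi>" and "\<forall>x\<ge>0. 0 \<le> \<Phi> x" and "mono_on {0..} \<Phi>"
    and "\<forall>x\<ge>0. \<forall>y\<ge>0. \<Phi> (x + y) \<le> \<Phi> x + \<Phi> y"
    and "\<forall>x\<ge>0. \<forall>y\<ge>0. \<Phi> (x * y) \<le> \<Phi> x * \<Phi> y"
    and "\<forall>x>0. 0 < \<Phi> x"
    and "continuous_on {0..} W" and "\<forall>x\<ge>0. 0 \<le> W x" and "mono_on {0..} W"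
    and "\<forall>x>0. 0 < W x"
    and "rd_continuous_on Ts Ts \<alpha>" and "\<forall>t\<in>Ts. 0 < \<alpha> t" and "mono_on Ts \<alpha>"
    and ineq: "\<forall>t\<in>Ts. u t \<le> \<alpha> t + delta_integral Ts a t (\<lambda>s. f s * u s)
          + delta_integral Ts a t
              (\<lambda>s. f s * h s * W (delta_integral Ts a s (\<lambda>\<tau>. \<beta> \<tau> * \<Phi> (u \<tau>))))"
    and p: "p = (\<lambda>t. 1 + delta_integral Ts a t (\<lambda>s. f s * ts_exp Ts f t (fwd_jump Ts s)))"
    and \<xi>: "\<xi> = delta_integral Ts a (bwd_jump Ts b) (\<lambda>s. \<beta> s * \<Phi> (p s * \<alpha> s))"
    and "x0 > 0"
    and \<Psi>: "\<Psi> = (\<lambda>x. LBINT s=ereal x0..ereal x. 1 / \<Phi> (W s))"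
    and \<Psi>inv: "\<Psi>inv = inv_into {0<..} \<Psi>"
  shows "\<forall>t\<in>Ts.
     \<Psi> \<xi> + delta_integral Ts a (bwd_jump Ts t)
              (\<lambda>\<tau>. \<beta> \<tau> * \<Phi> (p \<tau>) * \<Phi> (delta_integral Ts a \<tau> (\<lambda>\<theta>. f \<theta> * h \<theta>)))
        \<in> \<Psi> ` {0<..} \<longrightarrow>
     u t \<le> p t * \<alpha> t + p t * delta_integral Ts a t
       (\<lambda>s. f s * h s * W (\<Psi>inv (\<Psi> \<xi> + delta_integral Ts a s
              (\<lambda>\<tau>. \<beta> \<tau> * \<Phi> (p \<tau>) * \<Phi> (delta_integral Ts a \<tau> (\<lambda>\<theta>. f \<theta> * h \<theta>))))))"
proof -
  interpret bounded_time_scale Ts a b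
    using assms(1-4) by unfold_locales (auto simp: Ts time_scale_def)
  let ?K = "ts_kappa Ts"
  have u: "rd_continuous_on Ts ?K u" and \<alpha>: "rd_continuous_on Ts ?K \<alpha>"
    using assms(6,25) kappaD by (auto elim!: rd_continuous_on_subset)
  have u0: "0 \<le> u x" if "x \<in> Ts" for x
    using assms(7) that by blast
  have \<alpha>0: "0 < \<alpha> x" if "x \<in> Ts" for x
    using assms(26) that by blast
  have h: "rd_continuous_on Ts ?K h" and h0: "\<And>x. x \<in> ?K \<Longrightarrow> 0 \<le> h x"
    and f: "rd_continuous_on Ts ?K f" and f0: "\<And>x. x \<in> ?K \<Longrightarrow> 0 \<le> f x"
    and \<beta>: "rd_continuous_on Ts ?K \<beta>" and \<beta>0: "\<And>x. x \<in> ?K \<Longrightarrow> 0 \<le> \<beta> x"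
    using assms(8-13) by auto
  have \<Phi>: "continuous_on {0..} \<Phi>" and W: "continuous_on {0..} W"
    by fact+
  have \<Phi>0: "0 \<le> \<Phi> x" and W0: "0 \<le> W x" if "0 \<le> x" for x
    using that assms(16,22) by auto
  have \<Phi>_mono: "\<Phi> x \<le> \<Phi> y" and W_mono: "W x \<le> W y" if "0 \<le> x" "x \<le> y" for x y
    using that assms(17,23) by (auto simp: mono_on_def)
  have \<Phi>_add: "\<Phi> (x + y) \<le> \<Phi> x + \<Phi> y" and \<Phi>_mult: "\<Phi> (x * y) \<le> \<Phi> x * \<Phi> y"
    if "0 \<le> x" "0 \<le> y" for x y
    using that assms(18,19) by auto

  obtain E where E: "E a = 1" "\<And>x. 0 < E x" "\<And>x. x \<in> ?K \<Longrightarrow> has_delta_derivative Ts E (f x * E x) x"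
    using ex_exponential[OF f f0] by blast
  interpret ts_exponential Ts a b f E
    using f0 E by unfold_locales auto
  have pE: "p t = E t" if "t \<in> Ts" for t
    using E_eq_integral[OF that] by (simp add: p)
  have p_cont: "continuous_on Ts p"
    using continuous_on_E pE by (simp cong: continuous_on_cong)
  have p0: "0 < p x" if "x \<in> Ts" for x
    using that E_pos pE by simp

  have rd_cont: "rd_continuous_on Ts ?K g" if "continuous_on Ts g" for g
    using that kappaD by (intro continuous_imp_rd_continuous_on continuous_on_subset[OF that]) auto
  note rd_intros = rd_continuous_on_mult rd_continuous_on_compose_nonneg[OF _ _ \<Phi>]
    rd_continuous_on_compose_nonneg[OF _ _ W] u \<alpha> h f \<beta>

  define V where "V = (\<lambda>t. delta_integral Ts a t (\<lambda>x. \<beta> x * \<Phi> (u x)))"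
  have rdV: "rd_continuous_on Ts ?K (\<lambda>x. \<beta> x * \<Phi> (u x))"
    by (intro rd_intros) (auto intro: u0 kappaD)
  have V_cont: "continuous_on Ts V"
    unfolding V_def by (rule continuous_on_delta_integral[OF rdV])
  have intV0: "0 \<le> \<beta> x * \<Phi> (u x)" if "x \<in> ?K" for x
    using that by (intro mult_nonneg_nonneg \<beta>0 \<Phi>0 u0 kappaD)
  have V0: "0 \<le> V x" if "x \<in> Ts" for x
    unfolding V_def using that by (intro delta_integral_nonneg rdV intV0)
  have V_mono: "V x \<le> V y" if "x \<in> Ts" "y \<in> Ts" "x \<le> y" for x y
    unfolding V_def using that by (intro delta_integral_mono_limit rdV intV0)

  have rdH: "rd_continuous_on Ts ?K (\<lambda>x. f x * h x)"
    by (intro rd_intros)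
  define H where "H = (\<lambda>t. delta_integral Ts a t (\<lambda>x. f x * h x))"
  have fh0: "0 \<le> f x * h x" if "x \<in> ?K" for x
    using that by (intro mult_nonneg_nonneg f0 h0)
  have H_cont: "continuous_on Ts H"
    unfolding H_def by (rule continuous_on_delta_integral[OF rdH])
  have H0: "0 \<le> H x" if "x \<in> Ts" for x
    unfolding H_def using that by (intro delta_integral_nonneg rdH fh0)
  have H_mono: "H x \<le> H y" if "x \<in> Ts" "y \<in> Ts" "x \<le> y" for x y
    unfolding H_def using that by (intro delta_integral_mono_limit rdH fh0)

  define Z where "Z = (\<lambda>t. delta_integral Ts a t (\<lambda>x. f x * h x * W (V x)))"
  have rdZ: "rd_continuous_on Ts ?K (\<lambda>x. f x * h x * W (V x))"
    by (intro rd_intros rdH rd_cont V_cont) (auto intro: V0 kappaD)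
  have intZ0: "0 \<le> f x * h x * W (V x)" if "x \<in> ?K" for x
    using that by (intro mult_nonneg_nonneg[OF fh0] W0 V0 kappaD)
  have Z0: "0 \<le> Z x" if "x \<in> Ts" for x
    unfolding Z_def using that by (intro delta_integral_nonneg rdZ intZ0)
  have Z_mono: "Z x \<le> Z y" if "x \<in> Ts" "y \<in> Ts" "x \<le> y" for x y
    unfolding Z_def using that by (intro delta_integral_mono_limit rdZ intZ0)
  \<comment> \<open>\<open>V\<close> is nondecreasing, so \<open>W (V x)\<close> is at most
    \<open>W (V s)\<close> and can be taken out of the integral.\<close>
  have Z_le: "Z s \<le> W (V s) * H s" if s: "s \<in> Ts" for s
  proof -
    have "Z s \<le> delta_integral Ts a s (\<lambda>x. W (V s) * (f x * h x))"
      unfolding Z_def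
    proof (intro delta_integral_mono rdZ s)
      show "rd_continuous_on Ts ?K (\<lambda>x. W (V s) * (f x * h x))"
        by (intro rd_intros rdH rd_cont continuous_intros)
      fix x assume x: "x \<in> Ts" "x < s"
      then have "W (V x) \<le> W (V s)"
        using s by (intro W_mono V0 V_mono) auto
      then have "f x * h x * W (V x) \<le> f x * h x * W (V s)"
        using x le_b[OF s] by (intro mult_left_mono fh0 kappaI) auto
      then show "f x * h x * W (V x) \<le> W (V s) * (f x * h x)"
        by (simp add: mult.commute)
    qed
    also have "\<dots> = W (V s) * H s"
      unfolding H_def by (rule delta_integral_cmult[OF rdH s])
    finally show ?thesis .
  qed

  have u_le: "u t \<le> p t * \<alpha> t + p t * Z t" if t: "t \<in> Ts" for t
  proof -
    \<comment> \<open>Gronwall's inequality is available for a constant term. Both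
      \<open>\<alpha>\<close> and \<open>Z\<close> are nondecreasing, so freezing them at
      \<open>t\<close> preserves the inequality at all earlier points.\<close>
    have "u t \<le> (\<alpha> t + Z t) * E t"
    proof (rule gronwall[OF _ t])
      show "rd_continuous_on Ts ?K (\<lambda>x. f x * u x)"
        by (intro rd_intros)
      fix s assume s: "s \<in> Ts" "s \<le> t"
      have "u s \<le> \<alpha> s + delta_integral Ts a s (\<lambda>x. f x * u x) + Z s"
        using ineq s(1) by (auto simp: Z_def V_def)
      moreover have "\<alpha> s \<le> \<alpha> t"
        using assms(27) s t by (auto simp: mono_on_def)
      ultimately show "u s \<le> \<alpha> t + Z t + delta_integral Ts a s (\<lambda>x. f x * u x)"
        using Z_mono[OF s(1) t s(2)] by simp
    qed
    then show ?thesis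
      using pE[OF t] by (simp add: algebra_simps)
  qed

  define k where "k = (\<lambda>x. \<beta> x * \<Phi> (p x) * \<Phi> (H x))"
  define K where "K = (\<lambda>t. delta_integral Ts a t k)"
  have rdk: "rd_continuous_on Ts ?K k"
    unfolding k_def by (intro rd_intros rd_cont p_cont H_cont) (auto intro: H0 less_imp_le[OF p0] kappaD)
  have k0: "0 \<le> k x" if "x \<in> ?K" for x
    unfolding k_def using that
    by (intro mult_nonneg_nonneg \<beta>0 \<Phi>0 H0 less_imp_le[OF p0]) (auto intro: kappaD)
  have K_cont: "continuous_on Ts K"
    unfolding K_def by (rule continuous_on_delta_integral[OF rdk])
  have K0: "0 \<le> K x" if "x \<in> Ts" for x
    unfolding K_def using that by (intro delta_integral_nonneg rdk k0)
  have K_mono: "K x \<le> K y" if "x \<in> Ts" "y \<in> Ts" "x \<le> y" for x y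
    unfolding K_def using that by (intro delta_integral_mono_limit rdk k0)

  define w where "w = (\<lambda>x. \<Phi> (W x))"
  have w0: "0 \<le> w x" if "0 \<le> x" for x
    unfolding w_def using that by (intro \<Phi>0 W0)
  \<comment> \<open>The argument 0 is included because \<open>V\<close> may vanish.\<close>
  have w_le: "w x \<le> w y" if "0 \<le> x" "x \<le> y" for x y
    unfolding w_def using that by (intro \<Phi>_mono W0 W_mono)
  have prim: "bihari_primitive w \<Psi> x0"
  proof
    show "continuous_on {0<..} w"
      unfolding w_def
    proof (rule continuous_on_compose2[OF \<Phi> continuous_on_subset[OF W]])
      show "W ` {0<..} \<subseteq> {0..}"
        by (auto intro: W0)
    qed auto
    show "0 < w x" if "0 < x" for x
      unfolding w_def using assms(20,24) that by auto
    show "w x \<le> w y" if "0 < x" "x \<le> y" for x y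
      using that by (intro w_le) auto
  qed (use assms in \<open>auto simp: w_def\<close>)
  interpret bihari_primitive w \<Psi> x0 by (rule prim)

  define g where "g = (\<lambda>x. \<beta> x * \<Phi> (p x * \<alpha> x))"
  define X where "X = (\<lambda>t. delta_integral Ts a t g)"
  have p\<alpha>: "0 < p x * \<alpha> x" if "x \<in> Ts" for x
    using that by (intro mult_pos_pos p0 \<alpha>0)
  have rdg: "rd_continuous_on Ts ?K g"
    unfolding g_def by (intro rd_intros rd_cont p_cont) (auto intro: less_imp_le[OF p\<alpha>] kappaD)
  have g0: "0 \<le> g x" if "x \<in> ?K" for x
    unfolding g_def using that by (intro mult_nonneg_nonneg \<beta>0 \<Phi>0 less_imp_le[OF p\<alpha>]) (auto intro: kappaD)
  \<comment> \<open>\<open>X\<close> is bounded by \<open>\<xi>\<close> only up to the backward jump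
    of \<open>b\<close>. This suffices, as an integral up to \<open>t\<close> uses only points
    before \<open>t\<close>.\<close>
  define c0 where "c0 = bwd_jump Ts b"
  have c0: "c0 \<in> Ts"
    unfolding c0_def by (rule bwd_in[OF b_in])
  have X_le: "X s \<le> \<xi>" if "s \<in> Ts" "s \<le> c0" for s
  proof -
    have "X s \<le> X c0"
      unfolding X_def using that c0 by (intro delta_integral_mono_limit rdg g0)
    then show ?thesis
      by (simp add: \<xi> X_def g_def c0_def)
  qed
  have \<xi>0: "0 \<le> \<xi>"
    using X_le[OF a_in ge_a[OF c0]] by (simp add: X_def delta_integral_a)

  define Y where "Y = (\<lambda>t. delta_integral Ts a t (\<lambda>x. k x * w (V x)))"
  have rdY: "rd_continuous_on Ts ?K (\<lambda>x. k x * w (V x))"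
    unfolding w_def by (intro rd_intros rdk rd_cont V_cont) (auto intro: W0 V0 kappaD)
  have intY0: "0 \<le> k x * w (V x)" if "x \<in> ?K" for x
    using that by (intro mult_nonneg_nonneg k0 w0 V0 kappaD)
  have Y0: "0 \<le> Y x" if "x \<in> Ts" for x
    unfolding Y_def using that by (intro delta_integral_nonneg rdY intY0)
  \<comment> \<open>The Gronwall bound is inserted into \<open>V\<close>. Subadditivity splits off
    the part with \<open>\<alpha>\<close>; submultiplicativity separates \<open>p\<close>,
    \<open>W (V x)\<close> and \<open>H x\<close> in the rest.\<close>
  have V_le: "V s \<le> X s + Y s" if s: "s \<in> Ts" for s
  proof -
    have "V s \<le> delta_integral Ts a s (\<lambda>x. g x + k x * w (V x))"
      unfolding V_def
    proof (intro delta_integral_mono rdV s rd_continuous_on_add rdg)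
      show "rd_continuous_on Ts ?K (\<lambda>x. k x * w (delta_integral Ts a x (\<lambda>x. \<beta> x * \<Phi> (u x))))"
        using rdY by (simp add: V_def)
      fix x assume "x \<in> Ts" "x < s"
      then have x: "x \<in> Ts" "x \<in> ?K"
        using le_b[OF s] by (auto intro: kappaI)
      note nn = p\<alpha>[OF x(1)] p0[OF x(1)] Z0[OF x(1)] W0[OF V0[OF x(1)]] H0[OF x(1)]
      have "\<Phi> (Z x) \<le> \<Phi> (W (V x) * H x)"
        using nn x by (intro \<Phi>_mono Z_le) auto
      also have "\<dots> \<le> w (V x) * \<Phi> (H x)"
        unfolding w_def using nn by (intro \<Phi>_mult) auto
      finally have Z: "\<Phi> (p x) * \<Phi> (Z x) \<le> \<Phi> (p x) * (w (V x) * \<Phi> (H x))"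
        using nn by (intro mult_left_mono \<Phi>0) auto
      have "\<Phi> (u x) \<le> \<Phi> (p x * \<alpha> x + p x * Z x)"
        using x by (intro \<Phi>_mono u_le u0)
      also have "\<dots> \<le> \<Phi> (p x * \<alpha> x) + \<Phi> (p x * Z x)"
        using nn by (intro \<Phi>_add) auto
      also have "\<Phi> (p x * Z x) \<le> \<Phi> (p x) * \<Phi> (Z x)"
        using nn by (intro \<Phi>_mult) auto
      finally have "\<Phi> (u x) \<le> \<Phi> (p x * \<alpha> x) + \<Phi> (p x) * (w (V x) * \<Phi> (H x))"
        using Z by simp
      then have "\<beta> x * \<Phi> (u x) \<le> \<beta> x * (\<Phi> (p x * \<alpha> x) + \<Phi> (p x) * (w (V x) * \<Phi> (H x)))"
        using x by (intro mult_left_mono \<beta>0)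
      then show "\<beta> x * \<Phi> (u x) \<le> g x + k x * w (delta_integral Ts a x (\<lambda>x. \<beta> x * \<Phi> (u x)))"
        by (simp add: g_def k_def V_def algebra_simps)
    qed
    also have "\<dots> = X s + Y s"
      unfolding X_def Y_def by (rule delta_integral_add[OF rdg rdY s])
    finally show ?thesis .
  qed

  \<comment> \<open>If \<open>\<xi>\<close> is 0, the integral of \<open>g\<close> vanishes up to
    \<open>c0\<close>. The integrands of \<open>V\<close> and \<open>K\<close> are dominated by
    constant multiples of \<open>g\<close>, so these integrals vanish too.\<close>
  have degenerate: "V s = 0 \<and> K s = 0" if "\<xi> = 0" and s: "s \<in> Ts" "s \<le> c0" for s
  proof -
    have zero: "delta_integral Ts a s q \<le> 0"
      if q: "rd_continuous_on Ts ?K q" "\<And>x. x \<in> ?K \<Longrightarrow> q x \<le> C * g x" and "0 \<le> C" for q C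
    proof -
      have "delta_integral Ts a s q \<le> delta_integral Ts a s (\<lambda>x. C * g x)"
        using le_b[OF s(1)]
        by (intro delta_integral_mono q s rd_intros rdg rd_cont continuous_intros kappaI) auto
      also have "\<dots> = C * X s"
        unfolding X_def by (rule delta_integral_cmult[OF rdg s(1)])
      also have "\<dots> \<le> 0"
        using X_le[OF s] \<open>\<xi> = 0\<close> \<open>0 \<le> C\<close> by (simp add: mult_nonneg_nonpos)
      finally show ?thesis .
    qed
    have \<alpha>_le: "\<alpha> a \<le> \<alpha> x" if "x \<in> Ts" for x
      using assms(27) a_in that ge_a by (auto simp: mono_on_def)
    \<comment> \<open>The Gronwall bound is
      \<open>p x * \<alpha> x * (1 + Z x / \<alpha> x)\<close>, and its last factor is at most
      \<open>M\<close> because \<open>Z\<close> and \<open>\<alpha>\<close> are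
      nondecreasing.\<close>
    define M where "M = 1 + Z b / \<alpha> a"
    have "0 \<le> Z b / \<alpha> a"
      using Z0[OF b_in] \<alpha>0[OF a_in] by simp
    then have M: "0 \<le> M"
      by (simp add: M_def)
    have "\<beta> x * \<Phi> (u x) \<le> \<Phi> M * g x" if "x \<in> ?K" for x
    proof -
      have x: "x \<in> Ts"
        using that by (rule kappaD)
      have "Z x / \<alpha> x \<le> Z b / \<alpha> a"
        using Z_mono[OF x b_in le_b[OF x]] Z0[OF x] \<alpha>_le[OF x] \<alpha>0[OF a_in]
        by (intro frac_le Z0 b_in) auto
      then have "p x * \<alpha> x * (1 + Z x / \<alpha> x) \<le> p x * \<alpha> x * M"
        unfolding M_def using p\<alpha>[OF x] by (intro mult_left_mono) auto
      moreover have "p x * \<alpha> x * (1 + Z x / \<alpha> x) = p x * \<alpha> x + p x * Z x"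
        using \<alpha>0[OF x] by (simp add: field_simps)
      ultimately have "u x \<le> p x * \<alpha> x * M"
        using u_le[OF x] by simp
      then have "\<Phi> (u x) \<le> \<Phi> (p x * \<alpha> x * M)"
        by (intro \<Phi>_mono u0 x)
      also have "\<dots> \<le> \<Phi> (p x * \<alpha> x) * \<Phi> M"
        using p\<alpha>[OF x] M by (intro \<Phi>_mult) auto
      finally have "\<beta> x * \<Phi> (u x) \<le> \<beta> x * (\<Phi> (p x * \<alpha> x) * \<Phi> M)"
        using \<beta>0[OF that] by (intro mult_left_mono)
      then show ?thesis
        by (simp add: g_def mult_ac)
    qed
    then have "V s \<le> 0"
      unfolding V_def using M by (intro zero[OF rdV, of "\<Phi> M"] \<Phi>0)
    \<comment> \<open>\<open>p x\<close> is at most \<open>p x * \<alpha> x\<close> times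
      \<open>1 / \<alpha> a\<close>, and \<open>H x\<close> is at most \<open>H b\<close>;
      submultiplicativity then brings out the factor \<open>\<Phi> (p x * \<alpha> x)\<close> of
      \<open>g\<close>.\<close>
    define N where "N = \<Phi> (1 / \<alpha> a) * \<Phi> (H b)"
    have "k x \<le> N * g x" if "x \<in> ?K" for x
    proof -
      have x: "x \<in> Ts"
        using that by (rule kappaD)
      have "p x = p x * \<alpha> x * (1 / \<alpha> x)"
        using \<alpha>0[OF x] by simp
      also have "\<dots> \<le> p x * \<alpha> x * (1 / \<alpha> a)"
        using p\<alpha>[OF x] \<alpha>_le[OF x] \<alpha>0[OF a_in] by (intro mult_left_mono frac_le) auto
      finally have "\<Phi> (p x) \<le> \<Phi> (p x * \<alpha> x * (1 / \<alpha> a))"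
        using p0[OF x] by (intro \<Phi>_mono) auto
      also have "\<dots> \<le> \<Phi> (p x * \<alpha> x) * \<Phi> (1 / \<alpha> a)"
        using p\<alpha>[OF x] \<alpha>0[OF a_in] by (intro \<Phi>_mult) auto
      finally have 1: "\<Phi> (p x) \<le> \<Phi> (p x * \<alpha> x) * \<Phi> (1 / \<alpha> a)" .
      have 2: "\<Phi> (H x) \<le> \<Phi> (H b)"
        using x le_b[OF x] b_in by (intro \<Phi>_mono H_mono H0)
      have "\<Phi> (p x) * \<Phi> (H x) \<le> \<Phi> (p x * \<alpha> x) * \<Phi> (1 / \<alpha> a) * \<Phi> (H b)"
        using 1 2 p0[OF x] \<alpha>0[OF x] \<alpha>0[OF a_in] H0[OF x]
        by (intro mult_mono) (auto intro!: \<Phi>0 mult_nonneg_nonneg)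
      then have "\<beta> x * (\<Phi> (p x) * \<Phi> (H x)) \<le> \<beta> x * (\<Phi> (p x * \<alpha> x) * \<Phi> (1 / \<alpha> a) * \<Phi> (H b))"
        using \<beta>0[OF that] by (rule mult_left_mono)
      then show ?thesis
        by (simp add: k_def g_def N_def mult_ac)
    qed
    moreover have "0 \<le> N"
      unfolding N_def using \<alpha>0[OF a_in] H0[OF b_in] by (intro mult_nonneg_nonneg \<Phi>0) auto
    ultimately have "K s \<le> 0"
      unfolding K_def by (intro zero[OF rdk, of N])
    with \<open>V s \<le> 0\<close> show ?thesis
      using V0[OF s(1)] K0[OF s(1)] by simp
  qed

  show ?thesis
  proof (intro ballI impI)
    fix t assume t: "t \<in> Ts"
    define c where "c = bwd_jump Ts t"
    assume "\<Psi> \<xi> + delta_integral Ts a (bwd_jump Ts t)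
              (\<lambda>\<tau>. \<beta> \<tau> * \<Phi> (p \<tau>) * \<Phi> (delta_integral Ts a \<tau> (\<lambda>\<theta>. f \<theta> * h \<theta>)))
        \<in> \<Psi> ` {0<..}"
    then have range: "\<Psi> \<xi> + K c \<in> \<Psi> ` {0<..}"
      by (simp add: K_def k_def[abs_def] H_def c_def)
    then obtain q where q: "0 < q" "\<Psi> q = \<Psi> \<xi> + K c"
      by auto
    have c: "c \<in> Ts"
      unfolding c_def by (rule bwd_in[OF t])
    have "c \<le> c0"
      using bwd_jump_ge[OF t, of b] le_b[OF t] bwd_jump_le[of Ts t]
      by (cases "t = b") (auto simp: c_def c0_def)
    \<comment> \<open>The witness \<open>r\<close> stands in for \<open>\<xi>\<close>, which need
      not be positive. For positive \<open>\<xi>\<close> it is \<open>\<xi>\<close> itself. For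
      \<open>\<xi> = 0\<close> it is the preimage \<open>q\<close> given by the range hypothesis:
      \<open>K c = 0\<close> makes \<open>\<Psi> q\<close> equal to \<open>\<Psi> \<xi>\<close>,
      whatever that value is.\<close>
    have "\<exists>r>0. \<Psi> r = \<Psi> \<xi> \<and> (\<forall>s\<in>Ts. s \<le> c \<longrightarrow> V s \<le> \<Psi>inv (\<Psi> \<xi> + K s))"
    proof (cases "\<xi> = 0")
      case True
      then have "V s = 0 \<and> K s = 0" if "s \<in> Ts" "s \<le> c" for s
        using degenerate that \<open>c \<le> c0\<close> by auto
      moreover from this have "\<Psi> \<xi> + K c = \<Psi> \<xi>"
        using c by auto
      ultimately show ?thesis
        using q \<Psi>_inv(1)[OF range] by (intro exI[of _ q]) (auto simp: \<Psi>inv)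
    next
      case False
      then have "0 < \<xi>"
        using \<xi>0 by simp
      have "V s \<le> \<Psi>inv (\<Psi> \<xi> + K s)" if s: "s \<in> Ts" "s \<le> c" for s
      proof -
        \<comment> \<open>Replacing \<open>X\<close> by its constant upper bound
          \<open>\<xi>\<close> leaves the delta derivative \<open>k x * w (V x)\<close>, which is at
          most \<open>k x * w (R x)\<close> since \<open>V x \<le> R x\<close>.\<close>
        define R where "R = (\<lambda>x. \<xi> + Y x)"
        have R_pos: "0 < R x" if "x \<in> Ts" for x
          using Y0[OF that] \<open>0 < \<xi>\<close> by (simp add: R_def)
        have V_R: "V x \<le> R x" if "x \<in> Ts" "x \<le> c0" for x
          using V_le[OF that(1)] X_le[OF that] by (simp add: R_def)
        have "\<Psi> (R s) \<le> \<Psi> (R a) + delta_integral Ts a s k"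
        proof (rule bihari[OF prim rdk k0 s(1) _ R_pos])
          show "continuous_on Ts R"
            unfolding R_def Y_def by (intro continuous_intros continuous_on_delta_integral rdY)
          fix x assume x: "x \<in> Ts" "x < s"
          then have kappa: "x \<in> ?K"
            using le_b[OF s(1)] by (intro kappaI) auto
          from has_delta_derivative_add[OF x(1) has_delta_derivative_const[of Ts \<xi>] has_delta_derivative_delta_integral[OF rdY kappa]]
          show "has_delta_derivative Ts R (k x * w (V x)) x"
            by (simp add: R_def Y_def)
          show "0 \<le> k x * w (V x)"
            by (rule intY0[OF kappa])
          show "k x * w (V x) \<le> k x * w (R x)"
            using x s \<open>c \<le> c0\<close> by (intro mult_left_mono w_le V_R V0 k0 kappa) auto
        qed
        then have *: "\<Psi> (R s) \<le> \<Psi> \<xi> + K s"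
          by (simp add: R_def Y_def K_def delta_integral_a)
        \<comment> \<open>The range hypothesis concerns \<open>c\<close> only. At earlier points the
          value lies between \<open>\<Psi> \<xi>\<close> and \<open>\<Psi> q\<close>, and the range
          of \<open>\<Psi>\<close> has no holes.\<close>
        have "\<Psi> \<xi> + K s \<in> \<Psi> ` {\<xi>..q}"
          using K0[OF s(1)] K_mono[OF s(1) c s(2)] q \<open>0 < \<xi>\<close> by (intro \<Psi>_range_between) auto
        then have "\<Psi> \<xi> + K s \<in> \<Psi> ` {0<..}"
          using \<open>0 < \<xi>\<close> by auto
        note inv = \<Psi>_inv[OF this]
        have "R s \<le> \<Psi>inv (\<Psi> \<xi> + K s)"
          using * inv \<Psi>_le_iff[OF R_pos[OF s(1)] inv(1)] by (simp add: \<Psi>inv)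
        then show ?thesis
          using V_R[OF s(1)] s(2) \<open>c \<le> c0\<close> by simp
      qed
      then show ?thesis
        using \<open>0 < \<xi>\<close> by blast
    qed
    then obtain r where r: "0 < r" "\<Psi> r = \<Psi> \<xi>"
      and V_inv: "\<And>s. s \<in> Ts \<Longrightarrow> s \<le> c \<Longrightarrow> V s \<le> \<Psi>inv (\<Psi> \<xi> + K s)"
      by blast
    \<comment> \<open>Beyond \<open>c\<close> the argument of \<open>\<Psi>inv\<close> may leave the range of \<open>\<Psi>\<close>; freezing it at \<open>c\<close> keeps
      the integrand rd-continuous without changing it on \<open>[a, t)\<close>.\<close>
    define G where "G = (\<lambda>s. \<Psi>inv (\<Psi> \<xi> + min (K s) (K c)))"
    have arg: "\<Psi> \<xi> + min (K s) (K c) \<in> {\<Psi> r..\<Psi> q}" if "s \<in> Ts" for s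
      using K0[OF that] K0[OF c] r q by auto
    have G_cont: "continuous_on Ts G"
      unfolding G_def \<Psi>inv using arg
      by (intro continuous_on_compose2[OF continuous_on_\<Psi>_inv[OF r(1) q(1)]] continuous_intros K_cont) auto
    have G_pos: "0 < G s" if "s \<in> Ts" for s
      using \<Psi>_range_between[OF r(1) q(1), of "\<Psi> \<xi> + min (K s) (K c)"] arg[OF that] r(1)
      unfolding G_def \<Psi>inv by (intro \<Psi>_inv) auto
    have rdG: "rd_continuous_on Ts ?K (\<lambda>x. f x * h x * W (G x))"
      by (intro rd_intros rdH rd_cont G_cont) (auto intro: less_imp_le[OF G_pos] kappaD)
    have G_eq: "G s = \<Psi>inv (\<Psi> \<xi> + K s)" and G_ge: "V s \<le> G s" if s: "s \<in> Ts" "s < t" for s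
    proof -
      \<comment> \<open>A point strictly before \<open>t\<close> is at most the backward jump of
        \<open>t\<close>, so the range hypothesis there covers all points that the integral up to
        \<open>t\<close> uses.\<close>
      have "s \<le> c"
        unfolding c_def using s by (rule bwd_jump_ge)
      then show "G s = \<Psi>inv (\<Psi> \<xi> + K s)"
        using K_mono[OF s(1) c] by (simp add: G_def min_def)
      then show "V s \<le> G s"
        using V_inv[OF s(1) \<open>s \<le> c\<close>] by simp
    qed
    have "Z t \<le> delta_integral Ts a t (\<lambda>x. f x * h x * W (G x))"
      unfolding Z_def
    proof (intro delta_integral_mono rdZ rdG t)
      fix x assume x: "x \<in> Ts" "x < t"
      then have "x \<in> ?K"
        using le_b[OF t] by (intro kappaI) auto
      then show "f x * h x * W (V x) \<le> f x * h x * W (G x)"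
        using x by (intro mult_left_mono fh0 W_mono V0 G_ge)
    qed
    also have "\<dots> = delta_integral Ts a t (\<lambda>x. f x * h x * W (\<Psi>inv (\<Psi> \<xi> + K x)))"
      using G_eq by (intro delta_integral_cong ge_a t) auto
    finally have "u t \<le> p t * \<alpha> t + p t *
        delta_integral Ts a t (\<lambda>x. f x * h x * W (\<Psi>inv (\<Psi> \<xi> + K x)))"
      using u_le[OF t] mult_left_mono[OF _ less_imp_le[OF p0[OF t]]] by (meson add_left_mono order_trans)
    then show "u t \<le> p t * \<alpha> t + p t * delta_integral Ts a t
       (\<lambda>s. f s * h s * W (\<Psi>inv (\<Psi> \<xi> + delta_integral Ts a s
              (\<lambda>\<tau>. \<beta> \<tau> * \<Phi> (p \<tau>) * \<Phi> (delta_integral Ts a \<tau> (\<lambda>\<theta>. f \<theta> * h \<theta>))))))"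
      by (simp add: K_def k_def[abs_def] H_def)
  qed
qed

end
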